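(* For every $k$ with $2 \le k \le n$ (where $k$ may depend on $n$), the worst-case approximation ratio of the grammar-based compressor LZ78 satisfies $$\alpha_{\mathrm{LZ78}}(k,n) \in \Theta\left((n/\log n)^{2/3}\right).$$ That is, there are constants $c_1,c_2>0$ and $n_0$ such that for all $n\ge n_0$ and all $k$ with $2\le k\le n$ we have $c_1(n/\log n)^{2/3}\le \alpha_{\mathrm{LZ78}}(k,n)\le c_2(n/\log n)^{2/3}$.
   Context: A straight-line program (SLP) over a finite alphabet $\Sigma$ is a context-free grammar $\mathbb{A}=(N,\Sigma,P,S)$ with a finite set $N$ of nonterminals ($N\cap\Sigma=\emptyset$), start nonterminal $S\in N$, and a finite set $P$ of productions $A\to w$ with $A\in N$, $w\in(N\cup\Sigma)^+$, such that (i) for every $A\in N$ there is exactly one production with left-hand side $A$, and (ii) the relation $\{(A,B)\in N\times N \mid (A\to w)\in P,\ B \text{ occurs in } w\}$ is acyclic. Every nonterminal $A$ produces a unique word $\mathrm{val}(A)\in\Sigma^+$, and $\mathrm{val}(\mathbb{A})=\mathrm{val}(S)$. The size of $\mathbb{A}$ is $|\mathbb{A}|=\sum_{(A\to w)\in P}|w|$. For a nonempty word $w$, $g(w)$ denotes the size of a smallest SLP producing $w$. A grammar-based compressor $\mathcal{C}$ computes for each nonempty word $w$ an SLP $\mathcal{C}(w)$ with $\mathrm{val}(\mathcal{C}(w))=w$. With $[1,k]=\{1,\dots,k\}$, its worst-case approximation ratio is $$\alpha_{\mathcal{C}}(k,n)=\max\{|\mathcal{C}(w)|/g(w) \mid w\in[1,k]^n\}.$$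 LZ78: the LZ78-factorization of $w\in\Sigma^+$ is the unique list of words $f_1,\dots,f_\ell$ with $w=f_1\cdots f_\ell$ such that, with $f_0=\varepsilon$ (the empty word): $f_i\ne f_j$ for all $0\le i,j\le \ell-1$ with $i\ne j$; for all $1\le i\le \ell-1$ there exist $0\le j<i$ and $a\in\Sigma$ with $f_i=f_ja$; and $f_\ell=f_i$ for some $0\le i\le \ell-1$. (Equivalently, reading left to right, $f_k$ is the shortest prefix of the unprocessed suffix that differs from all $f_i$, $i<k$; if no such prefix exists, $f_\ell$ is the possibly empty unprocessed suffix.) The SLP produced by LZ78 has nonterminals $S,F_1,\dots,F_{\ell-1}$; for $1\le i\le \ell-1$ with $f_i=f_ja$ it has the rule $F_i\to F_ja$ if $j\ge 1$ and $F_i\to a$ if $j=0$; and the start rule is $S\to F_1\cdots F_{\ell-1}F_i$ where $f_\ell=f_i$ (the last symbol being omitted if $f_\ell=\varepsilon$). *)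

theory Defs
  imports Complex_Main
begin

section \<open>Straight-line programs\<close>

text \<open>
  Nonterminals and terminals are tagged by different constructors, which renders the
  disjointness of the nonterminals from the alphabet.
\<close>

datatype ('n, 'a) sym = NT 'n | T 'a

record ('n, 'a) slp =
  nonterms :: "'n set"
  alphabet :: "'a set"
  prods :: "('n \<times> ('n, 'a) sym list) set"
  start :: 'n

definition is_slp :: "('n, 'a) slp \<Rightarrow> bool" where
  "is_slp G \<longleftrightarrow>
     finite (nonterms G) \<and> finite (alphabet G) \<and> finite (prods G) \<and>
     start G \<in> nonterms G \<and>
     (\<forall>(A, w) \<in> prods G.
        A \<in> nonterms G \<and> w \<noteq> [] \<and> set w \<subseteq> NT ` nonterms G \<union> T ` alphabet G) \<and>
     (\<forall>A \<in> nonterms G. \<exists>!w. (A, w) \<in> prods G) \<and>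
     acyclic {(A, B). \<exists>w. (A, w) \<in> prods G \<and> NT B \<in> set w}"

definition derive_step ::
    "('n, 'a) slp \<Rightarrow> ('n, 'a) sym list \<Rightarrow> ('n, 'a) sym list \<Rightarrow> bool" where
  "derive_step G u v \<longleftrightarrow>
     (\<exists>l A r w. u = l @ [NT A] @ r \<and> (A, w) \<in> prods G \<and> v = l @ w @ r)"

abbreviation derives ::
    "('n, 'a) slp \<Rightarrow> ('n, 'a) sym list \<Rightarrow> ('n, 'a) sym list \<Rightarrow> bool" where
  "derives G \<equiv> (derive_step G)\<^sup>*\<^sup>*"

text \<open>
  The description operator is justified by \<open>is_slp_ex1_val\<close> below.
\<close>

definition nonterm_val :: "('n, 'a) slp \<Rightarrow> 'n \<Rightarrow> 'a list" where
  "nonterm_val G A = (THE w. derives G [NT A] (map T w))"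

definition slp_val :: "('n, 'a) slp \<Rightarrow> 'a list" where
  "slp_val G = nonterm_val G (start G)"

definition slp_size :: "('n, 'a) slp \<Rightarrow> nat" where
  "slp_size G = (\<Sum>(A, w) \<in> prods G. length w)"

text \<open>
  Since SLPs have finitely many nonterminals and may be renamed, it is no restriction to
  take the nonterminals from the type of natural numbers.
\<close>

definition smallest_slp_size :: "'a list \<Rightarrow> nat" where
  "smallest_slp_size w =
     (LEAST m. \<exists>G :: (nat, 'a) slp. is_slp G \<and> slp_val G = w \<and> slp_size G = m)"

definition approx_ratio :: "(nat list \<Rightarrow> (nat, nat) slp) \<Rightarrow> nat \<Rightarrow> nat \<Rightarrow> real" where
  "approx_ratio C k n =
     Max {real (slp_size (C w)) / real (smallest_slp_size w) | w.
            set w \<subseteq> {1..k} \<and> length w = n}"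


section \<open>LZ78\<close>

text \<open>
  A list \<open>fs\<close> represents the factors \<open>f\<^sub>1, \<dots>, f\<^sub>l\<close>; prepending the empty word makes
  list positions agree with the indices \<open>0, \<dots>, l\<close>.
\<close>

definition lz78_fac :: "'a list list \<Rightarrow> nat \<Rightarrow> 'a list" where
  "lz78_fac fs i = ([] # fs) ! i"

definition is_lz78_factorization :: "'a list \<Rightarrow> 'a list list \<Rightarrow> bool" where
  "is_lz78_factorization w fs \<longleftrightarrow>
     (let l = length fs; f = lz78_fac fs in
        l \<ge> 1 \<and> w = concat fs \<and>
        (\<forall>i < l. \<forall>j < l. i \<noteq> j \<longrightarrow> f i \<noteq> f j) \<and>
        (\<forall>i. 1 \<le> i \<and> i < l \<longrightarrow> (\<exists>j < i. \<exists>a. f i = f j @ [a])) \<and>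
        (\<exists>i < l. f l = f i))"

text \<open>
  The description operator is justified by \<open>lz78_factorization_ex1\<close> below.
\<close>

definition lz78_factorization :: "'a list \<Rightarrow> 'a list list" where
  "lz78_factorization w = (THE fs. is_lz78_factorization w fs)"

text \<open>
  The nonterminal \<open>S\<close> is encoded as \<open>0\<close> and \<open>F\<^sub>i\<close> as \<open>i\<close>. As the factors with indices
  below \<open>l\<close> are pairwise distinct, each comprehension contributes exactly one production
  per left-hand side.
\<close>

definition lz78 :: "'a list \<Rightarrow> (nat, 'a) slp" where
  "lz78 w =
     (let fs = lz78_factorization w; l = length fs; f = lz78_fac fs in
      \<lparr> nonterms = {..<l},
        alphabet = set w,
        prods =
          {(i, (if j = 0 then [] else [NT j]) @ [T a]) | i j a.
             1 \<le> i \<and> i < l \<and> j < i \<and> f i = f j @ [a]} \<union>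
          {(0, map NT [1..<l] @ (if i = 0 then [] else [NT i])) | i.
             i < l \<and> f l = f i},
        start = 0 \<rparr>)"


section \<open>Well-definedness\<close>

lemma derives_append_D:
  assumes "derives G z x" "z = u @ v"
  shows "\<exists>x1 x2. x = x1 @ x2 \<and> derives G u x1 \<and> derives G v x2"
  using assms(1,2)
proof (induction arbitrary: u v rule: converse_rtranclp_induct)
  case base
  then show ?case by blast
next
  case (step y z)
  from step.hyps(1) obtain l A r w where
    y: "y = l @ [NT A] @ r" and A: "(A, w) \<in> prods G" and z: "z = l @ w @ r"
    unfolding derive_step_def by blast
  have "(\<exists>u'. derive_step G u u' \<and> z = u' @ v) \<or> (\<exists>v'. derive_step G v v' \<and> z = u @ v')"
  proof -
    have "l @ [NT A] @ r = u @ v" using y step.prems by simp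
    then consider (a) q where "l = u @ q" "v = q @ [NT A] @ r"
      | (b) q where "u = l @ [NT A] @ q" "r = q @ v"
      by (auto simp: append_eq_append_conv2 Cons_eq_append_conv)
    then show ?thesis
    proof cases
      case a
      then have "derive_step G v (q @ w @ r)" using A unfolding derive_step_def by blast
      then show ?thesis using z a by auto
    next
      case b
      then have "derive_step G u (l @ w @ q)" using A unfolding derive_step_def by blast
      then show ?thesis using z b by auto
    qed
  qed
  then show ?case
  proof (elim disjE exE conjE)
    fix u' assume u': "derive_step G u u'" "z = u' @ v"
    obtain x1 x2 where "x = x1 @ x2" "derives G u' x1" "derives G v x2"
      using step.IH[OF u'(2)] by blast
    then show ?thesis using converse_rtranclp_into_rtranclp[of "derive_step G", OF u'(1)] by blast
  next
    fix v' assume v': "derive_step G v v'" "z = u @ v'"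
    obtain x1 x2 where "x = x1 @ x2" "derives G u x1" "derives G v' x2"
      using step.IH[OF v'(2)] by blast
    then show ?thesis using converse_rtranclp_into_rtranclp[of "derive_step G", OF v'(1)] by blast
  qed
qed

lemma derive_step_context:
  "derive_step G u v \<Longrightarrow> derive_step G (p @ u @ q) (p @ v @ q)"
proof -
  assume "derive_step G u v"
  then obtain l A r w where "u = l @ [NT A] @ r" "(A, w) \<in> prods G" "v = l @ w @ r"
    unfolding derive_step_def by blast
  then show ?thesis
    unfolding derive_step_def
    by (intro exI[of _ "p @ l"] exI[of _ A] exI[of _ "r @ q"] exI[of _ w]) simp
qed

lemma derives_context:
  "derives G u v \<Longrightarrow> derives G (p @ u @ q) (p @ v @ q)"
  by (induction rule: rtranclp_induct)
     (auto intro: rtranclp.rtrancl_into_rtrancl derive_step_context)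

lemma derives_append:
  assumes "derives G u x" "derives G v y"
  shows "derives G (u @ v) (x @ y)"
  using derives_context[OF assms(1), of "[]" v] derives_context[OF assms(2), of x "[]"]
  by simp

lemma derives_T:
  assumes "derives G [T a] x"
  shows "x = [T a]"
  using assms
  by (cases rule: converse_rtranclpE) (auto simp: derive_step_def Cons_eq_append_conv)

lemma derives_Nil:
  assumes "derives G [] x"
  shows "x = []"
  using assms by (cases rule: converse_rtranclpE) (auto simp: derive_step_def)

lemma ex1_derives_list:
  assumes "\<And>s. s \<in> set u \<Longrightarrow> \<exists>!w. derives G [s] (map T w)"
  shows "\<exists>!w. derives G u (map T w)"
  using assms
proof (induction u)
  case Nil
  show ?case by (rule ex1I[of _ "[]"]) (auto dest: derives_Nil)
next
  case (Cons s u)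
  obtain x where x: "derives G [s] (map T x)" "\<And>w. derives G [s] (map T w) \<Longrightarrow> w = x"
    using Cons.prems by (metis list.set_intros(1))
  obtain y where y: "derives G u (map T y)" "\<And>w. derives G u (map T w) \<Longrightarrow> w = y"
    using Cons by (metis list.set_intros(2))
  show ?case
  proof (rule ex1I[of _ "x @ y"])
    show "derives G (s # u) (map T (x @ y))"
      using derives_append[OF x(1) y(1)] by simp
  next
    fix w assume "derives G (s # u) (map T w)"
    from derives_append_D[OF this, of "[s]" u] obtain a b where
      "map T w = a @ b" "derives G [s] a" "derives G u b" by auto
    moreover from this(1) obtain w1 w2 where "w = w1 @ w2" "a = map T w1" "b = map T w2"
      unfolding map_eq_append_conv by blast
    ultimately show "w = x @ y"
      using x(2) y(2) by blast
  qed
qed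

lemma is_slp_ex1_val:
  assumes G: "is_slp G" and "A \<in> nonterms G"
  shows "\<exists>!w. derives G [NT A] (map T w)"
proof -
  let ?R = "{(A, B). \<exists>w. (A, w) \<in> prods G \<and> NT B \<in> set w}"
  have "?R \<subseteq> nonterms G \<times> nonterms G"
    using G unfolding is_slp_def by fastforce
  then have "finite ?R"
    using G unfolding is_slp_def by (meson finite_SigmaI finite_subset)
  moreover have "acyclic ?R" using G unfolding is_slp_def by blast
  ultimately have "wf (?R\<inverse>)" by (rule finite_acyclic_wf_converse)
  then show ?thesis using assms(2)
  proof (induction A rule: wf_induct_rule)
    case (less A)
    obtain u where u: "(A, u) \<in> prods G" "\<And>w. (A, w) \<in> prods G \<Longrightarrow> w = u"
      using G less.prems unfolding is_slp_def by metis
    have "\<exists>!w. derives G u (map T w)"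
    proof (rule ex1_derives_list)
      fix s assume s: "s \<in> set u"
      show "\<exists>!w. derives G [s] (map T w)"
      proof (cases s)
        case (NT B)
        then have "B \<in> nonterms G" using s u(1) G unfolding is_slp_def by fastforce
        then show ?thesis using less.IH[of B] NT s u(1) by auto
      next
        case (T a)
        show ?thesis unfolding T
          by (rule ex1I[of _ "[a]"]) (auto dest: derives_T)
      qed
    qed
    moreover have "derives G [NT A] (map T w) \<longleftrightarrow> derives G u (map T w)" for w
    proof
      assume "derives G [NT A] (map T w)"
      then show "derives G u (map T w)"
      proof (cases rule: converse_rtranclpE)
        case base
        then show ?thesis by auto
      next
        case (step y)
        then have "y = u" using u(2)
          by (auto simp: derive_step_def Cons_eq_append_conv)
        then show ?thesis using step by simp
      qed
    next
      have "derive_step G [NT A] u"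
        using u(1) unfolding derive_step_def by force
      then show "derives G u (map T w) \<Longrightarrow> derives G [NT A] (map T w)"
        by (rule converse_rtranclp_into_rtranclp)
    qed
    ultimately show ?case by simp
  qed
qed

definition lz78_dict :: "'a list list \<Rightarrow> bool" where
  "lz78_dict gs \<longleftrightarrow> distinct ([] # gs) \<and>
     (\<forall>i < length gs. \<exists>d \<in> set ([] # take i gs). \<exists>a. gs ! i = d @ [a])"

lemma lz78_dict_snoc:
  "lz78_dict (gs @ [g]) \<longleftrightarrow>
     lz78_dict gs \<and> g \<notin> set ([] # gs) \<and> (\<exists>d \<in> set ([] # gs). \<exists>a. g = d @ [a])"
proof -
  have "distinct ([] # gs @ [g]) \<longleftrightarrow> distinct ([] # gs) \<and> g \<notin> set ([] # gs)"
    by auto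
  moreover have "(\<forall>i < length (gs @ [g]).
      \<exists>d \<in> set ([] # take i (gs @ [g])). \<exists>a. (gs @ [g]) ! i = d @ [a]) \<longleftrightarrow>
    (\<exists>d \<in> set ([] # gs). \<exists>a. g = d @ [a]) \<and>
    (\<forall>i < length gs. \<exists>d \<in> set ([] # take i gs). \<exists>a. gs ! i = d @ [a])"
    unfolding length_append_singleton All_less_Suc
    by (simp add: nth_append del: list.set bex_simps cong: all_cong)
  ultimately show ?thesis
    unfolding lz78_dict_def by blast
qed

lemma is_lz78_factorization_snoc:
  "is_lz78_factorization w (gs @ [g]) \<longleftrightarrow>
     w = concat gs @ g \<and> lz78_dict gs \<and> g \<in> set ([] # gs)"
proof -
  let ?f = "lz78_fac (gs @ [g])" and ?n = "length gs"
  have f: "?f i = ([] # gs) ! i" if "i < Suc ?n" for i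
    using that by (auto simp: lz78_fac_def nth_append nth_Cons')
  have g: "?f (Suc ?n) = g" by (simp add: lz78_fac_def)
  have 1: "(\<forall>i < Suc ?n. \<forall>j < Suc ?n. i \<noteq> j \<longrightarrow> ?f i \<noteq> ?f j) \<longleftrightarrow> distinct ([] # gs)"
    by (simp add: distinct_conv_nth f del: distinct.simps)
  have 2: "(\<exists>i < Suc ?n. ?f (Suc ?n) = ?f i) \<longleftrightarrow> g \<in> set ([] # gs)"
    unfolding g in_set_conv_nth using f by auto
  have 3: "(\<exists>j < Suc i. \<exists>a. ?f (Suc i) = ?f j @ [a]) \<longleftrightarrow>
      (\<exists>d \<in> set ([] # take i gs). \<exists>a. gs ! i = d @ [a])" (is "?L \<longleftrightarrow> ?R") if "i < ?n" for i
  proof -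
    have s: "set ([] # take i gs) = (\<lambda>j. ([] # gs) ! j) ` {..<Suc i}"
      using nth_image[of "Suc i" "[] # gs"] that by (simp add: atLeast0LessThan)
    show ?thesis using that f unfolding s by (auto simp: Bex_def)
  qed
  have 4: "(\<forall>i. 1 \<le> i \<and> i < Suc ?n \<longrightarrow> (\<exists>j < i. \<exists>a. ?f i = ?f j @ [a])) \<longleftrightarrow>
      (\<forall>i < ?n. \<exists>d \<in> set ([] # take i gs). \<exists>a. gs ! i = d @ [a])" (is "?L \<longleftrightarrow> ?R")
  proof -
    have "?L \<longleftrightarrow> (\<forall>i < ?n. \<exists>j < Suc i. \<exists>a. ?f (Suc i) = ?f j @ [a])"
      by (metis Suc_le_D Suc_less_eq One_nat_def le_add1 plus_1_eq_Suc)
    then show ?thesis using 3 by simp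
  qed
  show ?thesis
    unfolding is_lz78_factorization_def Let_def lz78_dict_def length_append_singleton 1 2 4
    by auto
qed

lemma lz78_dict_prefix:
  assumes "lz78_dict gs" "u @ v \<in> set ([] # gs)"
  shows "u \<in> set ([] # gs)"
  using assms
proof (induction gs arbitrary: u v rule: rev_induct)
  case Nil
  then show ?case by simp
next
  case (snoc g gs)
  have IH: "u' \<in> set ([] # gs)" if "u' @ v' \<in> set ([] # gs)" for u' v'
    using snoc.IH[OF _ that] snoc.prems(1) by (simp only: lz78_dict_snoc)
  have "u \<in> set ([] # gs) \<or> u = g"
  proof (cases "u @ v \<in> set ([] # gs)")
    case True
    then show ?thesis using IH by blast
  next
    case False
    then have g: "u @ v = g" using snoc.prems(2) by auto
    obtain d a where d: "d \<in> set ([] # gs)" "g = d @ [a]"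
      using snoc.prems(1) unfolding lz78_dict_snoc by blast
    show ?thesis
    proof (cases v rule: rev_cases)
      case Nil
      then show ?thesis using g by simp
    next
      case (snoc v' b)
      then have "u @ v' = d" using g d by simp
      then show ?thesis using IH d(1) by blast
    qed
  qed
  then show ?case by auto
qed

lemma lz78_dict_appendD: "lz78_dict (gs @ hs) \<Longrightarrow> lz78_dict gs"
proof (induction hs rule: rev_induct)
  case (snoc h hs)
  then show ?case
    unfolding append.assoc[symmetric] by (simp only: lz78_dict_snoc)
qed simp

lemma lz78_dict_ConsD:
  "lz78_dict (gs @ h # hs) \<Longrightarrow> lz78_dict (gs @ [h])"
  using lz78_dict_appendD[of "gs @ [h]" hs] by simp

lemma lz78_dict_no_strict_prefix:
  assumes "lz78_dict (gs @ [f])" "lz78_dict (gs @ [f @ u])"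
  shows "u = []"
proof (cases u rule: rev_cases)
  case (snoc v b)
  have gs: "lz78_dict gs" "f \<notin> set ([] # gs)"
    using assms(1) unfolding lz78_dict_snoc by blast+
  obtain d a where d: "d \<in> set ([] # gs)" "f @ u = d @ [a]"
    using assms(2) unfolding lz78_dict_snoc by blast
  then have "f @ v = d" using snoc by simp
  then show ?thesis using lz78_dict_prefix[OF gs(1), of f v] d(1) gs(2) by blast
qed

lemma lz78_factors_unique:
  assumes "lz78_dict (D @ F)" "lz78_dict (D @ G)" "concat F @ x = concat G @ y"
    and "x \<in> set ([] # D @ F)" "y \<in> set ([] # D @ G)"
  shows "F = G"
  using assms
proof (induction F arbitrary: D G)
  case Nil
  show ?case
  proof (cases G)
    case (Cons g G')
    have D: "lz78_dict D" "g \<notin> set ([] # D)"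
      using lz78_dict_ConsD Nil.prems(2) unfolding Cons lz78_dict_snoc by blast+
    then show ?thesis
      using lz78_dict_prefix[OF D(1), of g "concat G' @ y"] Nil.prems Cons by simp
  qed simp
next
  case (Cons f F)
  have f: "lz78_dict (D @ [f])" using lz78_dict_ConsD Cons.prems(1) .
  then have D: "lz78_dict D" "f \<notin> set ([] # D)" unfolding lz78_dict_snoc by blast+
  show ?case
  proof (cases G)
    case Nil
    then have "f @ concat F @ x \<in> set ([] # D)" using Cons.prems(3,5) by simp
    then show ?thesis using lz78_dict_prefix[OF D(1)] D(2) by blast
  next
    case (Cons g G')
    have g: "lz78_dict (D @ [g])" using lz78_dict_ConsD Cons.prems(2) unfolding Cons .
    have "f @ concat F @ x = g @ concat G' @ y" using Cons.prems(3) Cons by simp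
    then obtain u where "f = g @ u \<or> g = f @ u"
      unfolding append_eq_append_conv2 by blast
    then have fg: "f = g" using lz78_dict_no_strict_prefix f g by force
    have "F = G'"
      by (rule Cons.IH[of "D @ [f]"]) (use Cons.prems fg Cons in \<open>simp_all\<close>)
    then show ?thesis using fg Cons by simp
  qed
qed

lemma lz78_factors_exist:
  assumes "lz78_dict D"
  shows "\<exists>F x. r = concat F @ x \<and> lz78_dict (D @ F) \<and> x \<in> set ([] # D @ F)"
  using assms
proof (induction "length r" arbitrary: r D rule: less_induct)
  case less
  show ?case
  proof (cases "r \<in> set ([] # D)")
    case True
    then show ?thesis using less.prems by (intro exI[of _ "[]"] exI[of _ r]) auto
  next
    case False
    define n where "n = (LEAST n. take n r \<notin> set ([] # D))"
    have n: "take n r \<notin> set ([] # D)"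
      unfolding n_def by (rule LeastI[of _ "length r"]) (use False in simp)
    have min: "take m r \<in> set ([] # D)" if "m < n" for m
      using not_less_Least that unfolding n_def by blast
    have "n \<noteq> 0" using n by (intro notI) simp
    then obtain m where m: "n = Suc m" using not0_implies_Suc by blast
    have "m < length r"
    proof (rule ccontr)
      assume "\<not> m < length r"
      then have "take n r = take m r" using m by simp
      then show False using n min[of m] m by simp
    qed
    then have "take n r = take m r @ [r ! m]" using m by (simp add: take_Suc_conv_app_nth)
    then have dict: "lz78_dict (D @ [take n r])"
      unfolding lz78_dict_snoc using n min[of m] m less.prems by blast
    have "length (drop n r) < length r" using \<open>m < length r\<close> m by simp
    from less.hyps[OF this dict] obtain F x where
      "drop n r = concat F @ x" "lz78_dict ((D @ [take n r]) @ F)"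
      "x \<in> set ([] # (D @ [take n r]) @ F)" by blast
    then have "r = concat (take n r # F) @ x \<and> lz78_dict (D @ take n r # F) \<and>
        x \<in> set ([] # D @ take n r # F)"
      using append_take_drop_id[of n r] by simp
    then show ?thesis by blast
  qed
qed

lemma lz78_factorization_ex1: "\<exists>!fs. is_lz78_factorization w fs"
proof -
  have "lz78_dict []" by (simp add: lz78_dict_def)
  then obtain F x where F: "w = concat F @ x" "lz78_dict F" "x \<in> set ([] # F)"
    using lz78_factors_exist[of "[]" w] by auto
  show ?thesis
  proof (rule ex1I[of _ "F @ [x]"])
    show "is_lz78_factorization w (F @ [x])"
      using F unfolding is_lz78_factorization_snoc by blast
  next
    fix gs assume gs: "is_lz78_factorization w gs"
    show "gs = F @ [x]"
    proof (cases gs rule: rev_cases)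
      case Nil
      then show ?thesis using gs by (simp add: is_lz78_factorization_def)
    next
      case (snoc G y)
      then have G: "w = concat G @ y" "lz78_dict G" "y \<in> set ([] # G)"
        using gs unfolding snoc is_lz78_factorization_snoc by blast+
      then have "F = G" using lz78_factors_unique[of "[]" F G x y] F by simp
      then show ?thesis using F(1) G(1) snoc by simp
    qed
  qed
qed

lemma lz78_is_slp_val:
  assumes "w \<noteq> []"
  shows "is_slp (lz78 w) \<and> slp_val (lz78 w) = w"
proof -
  define fs where "fs = lz78_factorization w"
  have fs: "is_lz78_factorization w fs"
    unfolding fs_def lz78_factorization_def by (rule theI'[OF lz78_factorization_ex1])
  define l where "l = length fs"
  define f where "f = lz78_fac fs"
  have l: "l \<ge> 1" and w: "w = concat fs"
    and dist: "\<And>i j. i < l \<Longrightarrow> j < l \<Longrightarrow> f i = f j \<Longrightarrow> i = j"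
    and ext: "\<And>i. 1 \<le> i \<Longrightarrow> i < l \<Longrightarrow> \<exists>j < i. \<exists>a. f i = f j @ [a]"
    and last: "\<exists>i < l. f l = f i"
    using fs unfolding is_lz78_factorization_def Let_def l_def f_def by blast+
  have f0: "f 0 = []" and f_Suc: "f (Suc i) = fs ! i" for i
    by (simp_all add: f_def lz78_fac_def)
  have "fs = map f [1..<Suc l]"
    by (rule nth_equalityI) (simp_all add: l_def f_Suc del: upt_Suc)
  then have w_f: "w = concat (map f [1..<l]) @ f l"
    using l w by simp
  obtain m where m: "m < l" "f l = f m" using last by blast
  have l2: "1 < l"
  proof (rule ccontr)
    assume "\<not> 1 < l"
    then have "l = 1" using l by simp
    then show False using w_f m f0 assms by simp
  qed
  have f_set: "set (f i) \<subseteq> set w" if "i < l" for i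
  proof (cases "i = 0")
    case False
    then have "i \<in> set [1..<l]" using that by simp
    then show ?thesis unfolding w_f by fastforce
  qed (simp add: f0)

  define G where "G = lz78 w"
  define R where "R j a = (if j = 0 then [] else [NT j]) @ [T a]" for j :: nat and a :: 'a
  define M where "M = map NT [1..<l] @ (if m = 0 then [] else [NT m :: (nat, 'a) sym])"
  have M: "i < l \<and> f l = f i \<longleftrightarrow> i = m" for i
    using m dist by metis
  have N: "nonterms G = {..<l}" and \<Sigma>: "alphabet G = set w" and S: "start G = 0"
    and P: "prods G = {(i, R j a) | i j a. 1 \<le> i \<and> i < l \<and> j < i \<and> f i = f j @ [a]} \<union> {(0, M)}"
    unfolding G_def lz78_def Let_def fs_def[symmetric] l_def[symmetric] f_def[symmetric] M
    by (simp_all add: R_def M_def)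
  have P0: "(0, v) \<in> prods G \<longleftrightarrow> v = M" for v
    unfolding P by simp
  have P1: "(i, v) \<in> prods G \<longleftrightarrow> i < l \<and> (\<exists>j < i. \<exists>a. f i = f j @ [a] \<and> v = R j a)"
    if "1 \<le> i" for i v
    unfolding P using that by auto
  have P1_ex1: "\<exists>!v. (i, v) \<in> prods G" if i: "1 \<le> i" "i < l" for i
  proof -
    obtain j a where j: "j < i" "f i = f j @ [a]" using ext[OF i] by blast
    have "j' = j \<and> a' = a" if "j' < i" "f i = f j' @ [a']" for j' a'
      using that j dist[of j j'] i(2) by auto
    then have "(i, v) \<in> prods G \<longleftrightarrow> v = R j a" for v
      unfolding P1[OF i(1)] using j that by metis
    then show ?thesis by simp
  qed
  have "finite (prods G)"
  proof -
    have "prods G \<subseteq>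
        (\<lambda>(i, j). (i, R j (List.last (f i)))) ` ({..<l} \<times> {..<l}) \<union> {(0, M)}"
      unfolding P by (force simp: image_iff)
    then show ?thesis by (rule finite_subset) simp
  qed
  moreover have "\<forall>(A, v) \<in> prods G.
      A \<in> nonterms G \<and> v \<noteq> [] \<and> set v \<subseteq> NT ` nonterms G \<union> T ` alphabet G"
  proof -
    have "A < l \<and> v \<noteq> [] \<and> set v \<subseteq> NT ` {..<l} \<union> T ` set w" if Av: "(A, v) \<in> prods G" for A v
    proof (cases "A = 0")
      case True
      then have "v = M" using Av P0 by simp
      then show ?thesis using True l2 m by (auto simp: M_def)
    next
      case False
      then obtain j a where *: "A < l" "j < A" "f A = f j @ [a]" "v = R j a"
        using Av P1[of A v] by auto
      then have "a \<in> set w" using f_set[of A] by auto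
      then show ?thesis using * by (auto simp: R_def)
    qed
    then show ?thesis unfolding N \<Sigma> by blast
  qed
  moreover have "\<forall>A \<in> nonterms G. \<exists>!v. (A, v) \<in> prods G"
  proof
    fix A assume "A \<in> nonterms G"
    then show "\<exists>!v. (A, v) \<in> prods G"
      using P0 P1_ex1[of A] N by (cases "A = 0") auto
  qed
  moreover have "acyclic {(A, B). \<exists>v. (A, v) \<in> prods G \<and> NT B \<in> set v}" (is "acyclic ?E")
  proof -
    have "B \<noteq> 0 \<and> B < (if A = 0 then l else A)" if "(A, v) \<in> prods G" "NT B \<in> set v" for A B v
    proof (cases "A = 0")
      case True
      then have "v = M" using that(1) P0 by simp
      then show ?thesis using True that(2) m(1) by (auto simp: M_def split: if_splits)
    next
      case False
      then have "1 \<le> A" by simp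
      from that(1) obtain j a where "j < A" "v = R j a" unfolding P1[OF \<open>1 \<le> A\<close>] by blast
      then show ?thesis using False that(2) by (auto simp: R_def split: if_splits)
    qed
    then have "?E\<inverse> \<subseteq> measure (\<lambda>A. if A = 0 then l else A)"
      by fastforce
    then have "wf (?E\<inverse>)" by (rule wf_subset[OF wf_measure])
    from wf_acyclic[OF this] show ?thesis by (simp only: acyclic_converse)
  qed
  ultimately have slp: "is_slp G"
    unfolding is_slp_def N \<Sigma> S using l2 by auto

  have step: "derives G [NT A] x" if "(A, v) \<in> prods G" "derives G v x" for A v x
  proof -
    have "derive_step G [NT A] v" using that(1) unfolding derive_step_def by force
    then show ?thesis using that(2) by (rule converse_rtranclp_into_rtranclp)
  qed
  have F: "derives G [NT i] (map T (f i))" if "1 \<le> i" "i < l" for i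
    using that
  proof (induction i rule: less_induct)
    case (less i)
    obtain j a where j: "j < i" "f i = f j @ [a]" using ext less.prems by blast
    then have "(i, R j a) \<in> prods G" using P1 less.prems by blast
    moreover have "derives G (R j a) (map T (f i))"
    proof (cases "j = 0")
      case True
      then show ?thesis using j f0 by (simp add: R_def)
    next
      case False
      then have "derives G [NT j] (map T (f j))" using less j by simp
      then show ?thesis
        using derives_append[of G "[NT j]" "map T (f j)" "[T a]" "[T a]"] j False
        by (simp add: R_def)
    qed
    ultimately show ?case by (rule step)
  qed
  have Fs: "derives G (map NT is) (map T (concat (map f is)))" if "set is \<subseteq> {1..<l}" for "is"
    using that
  proof (induction "is")
    case (Cons i "is")
    then show ?case using derives_append[OF F[of i] Cons.IH] by simp
  qed simp
  have "derives G (if m = 0 then [] else [NT m]) (map T (f m))"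
    using F[of m] m f0 by simp
  then have "derives G M (map T w)"
    unfolding M_def w_f m(2) map_append by (intro derives_append Fs) auto
  then have "derives G [NT (start G)] (map T w)"
    using step P0 S by simp
  moreover have "start G \<in> nonterms G" using slp unfolding is_slp_def by blast
  ultimately have "slp_val G = w"
    unfolding slp_val_def nonterm_val_def using is_slp_ex1_val[OF slp] by (simp add: the1_equality)
  then show ?thesis using slp unfolding G_def by blast
qed

end

theory Submission
  imports Defs "HOL-Real_Asymp.Real_Asymp"
begin

text \<open>
  Upper bound: a word \<open>w\<close> of length \<open>n\<close> with a program of size \<open>g\<close> has at most \<open>g j\<close> factors
  of length \<open>j\<close>, since each of them crosses the end of a right-hand side symbol of some rule at
  one of \<open>j\<close> offsets.  The LZ78 phrases are distinct, so for every \<open>q\<close> there are at most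
  \<open>g q\<^sup>2\<close> phrases of length at most \<open>q\<close> and \<open>n / q\<close> longer ones.  The choice
  \<open>q \<approx> (n / g) powr (1 / 3)\<close> bounds the ratio by \<open>O((n / g) powr (2 / 3))\<close>, and \<open>g \<ge> ln n\<close>.

  Lower bound: with \<open>m \<approx> ln n\<close> and \<open>K \<approx> (n / ln n) powr (1 / 3)\<close>, consider
  \<open>a\<^sup>M (b a\<^sup>K)\<^sup>N (\<Prod>\<^sub>t b a\<^sup>t b a\<^sup>K)\<^sup>N a\<^sup>r\<close> for \<open>N = (K + 1)\<^sup>2\<close>, \<open>1 \<le> t \<le> m\<close>.
  The first block makes every \<open>a\<^sup>x\<close> a phrase.  LZ78 reads a power of a product of words \<open>c\<^sub>t a\<^sup>K\<close> in
  phrases \<open>a\<^sup>x c\<^sub>t a\<^sup>y\<close> with \<open>y\<close> counting the earlier visits to \<open>(x, t)\<close>, i.e. as a rotor walk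
  on an Eulerian graph, and this walk is an Eulerian tour.  So the second block makes every
  \<open>a\<^sup>x b a\<^sup>t\<close> a phrase, after which no separator \<open>b a\<^sup>t b\<close> is cut, and the third block
  contributes \<open>m N\<close> phrases, whereas the word has a program of size \<open>O(ln n)\<close>.
\<close>


section \<open>Words produced by straight-line programs\<close>

definition sym_val :: "('n, 'a) slp \<Rightarrow> ('n, 'a) sym list \<Rightarrow> 'a list" where
  "sym_val G u = concat (map (case_sym (nonterm_val G) (\<lambda>a. [a])) u)"

lemma sym_val_simps [simp]:
  "sym_val G [] = []"
  "sym_val G (NT A # u) = nonterm_val G A @ sym_val G u"
  "sym_val G (T a # u) = a # sym_val G u"
  "sym_val G (u @ v) = sym_val G u @ sym_val G v"
  by (simp_all add: sym_val_def)

lemma nonterm_val_eqI: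
  assumes "is_slp G" "A \<in> nonterms G" "derives G [NT A] (map T w)"
  shows "nonterm_val G A = w"
  unfolding nonterm_val_def using is_slp_ex1_val[OF assms(1,2)] assms(3) by (rule the1_equality)

lemma derives_nonterm_val:
  assumes "is_slp G" "A \<in> nonterms G"
  shows "derives G [NT A] (map T (nonterm_val G A))"
  unfolding nonterm_val_def by (rule theI'[OF is_slp_ex1_val[OF assms]])

lemma derives_prod:
  assumes "(A, v) \<in> prods G" "derives G v x"
  shows "derives G [NT A] x"
proof -
  have "derive_step G [NT A] v" using assms(1) unfolding derive_step_def by force
  then show ?thesis using assms(2) by (rule converse_rtranclp_into_rtranclp)
qed

lemma derives_symbols:
  assumes "\<And>A. NT A \<in> set u \<Longrightarrow> derives G [NT A] (map T (val A))"
  shows "derives G u (map T (concat (map (case_sym val (\<lambda>a. [a])) u)))"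
  using assms
proof (induction u)
  case (Cons s u)
  then have "derives G u (map T (concat (map (case_sym val (\<lambda>a. [a])) u)))" by simp
  moreover have "derives G [s] (map T (case_sym val (\<lambda>a. [a]) s))"
    using Cons.prems by (cases s) auto
  ultimately show ?case using derives_append[of G "[s]" _ u] by fastforce
qed simp

lemma prods_nonterms:
  assumes "is_slp G" "(A, v) \<in> prods G"
  shows "A \<in> nonterms G" "v \<noteq> []" "NT B \<in> set v \<Longrightarrow> B \<in> nonterms G"
  using assms unfolding is_slp_def by fastforce+

lemma nonterm_val_prod:
  assumes G: "is_slp G" and Av: "(A, v) \<in> prods G"
  shows "nonterm_val G A = sym_val G v"
proof (rule nonterm_val_eqI[OF G prods_nonterms(1)[OF G Av] derives_prod[OF Av]])
  show "derives G v (map T (sym_val G v))"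
    unfolding sym_val_def
    by (intro derives_symbols derives_nonterm_val G prods_nonterms(3)[OF G Av])
qed

definition prod_rel :: "('n, 'a) slp \<Rightarrow> ('n \<times> 'n) set" where
  "prod_rel G = {(A, B). \<exists>v. (A, v) \<in> prods G \<and> NT B \<in> set v}"

lemma prod_rel_facts:
  assumes G: "is_slp G"
  shows "prod_rel G \<subseteq> nonterms G \<times> nonterms G" "acyclic (prod_rel G)" "wf ((prod_rel G)\<inverse>)"
proof -
  show R: "prod_rel G \<subseteq> nonterms G \<times> nonterms G"
    using G unfolding is_slp_def prod_rel_def by fastforce
  show ac: "acyclic (prod_rel G)"
    using G unfolding is_slp_def prod_rel_def by blast
  show "wf ((prod_rel G)\<inverse>)"
    by (rule finite_acyclic_wf_converse[OF finite_subset[OF R] ac])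
       (use G in \<open>auto simp: is_slp_def\<close>)
qed

lemma slp_induct [consumes 2, case_names nonterm]:
  assumes G: "is_slp G" and A: "A \<in> nonterms G"
    and step: "\<And>A v. (A, v) \<in> prods G \<Longrightarrow> (\<And>B. NT B \<in> set v \<Longrightarrow> P B) \<Longrightarrow> P A"
  shows "P A"
  using prod_rel_facts(3)[OF G] A
proof (induction A rule: wf_induct_rule)
  case (less A)
  obtain v where v: "(A, v) \<in> prods G" using G less.prems unfolding is_slp_def by blast
  show ?case
  proof (rule step[OF v])
    fix B assume "NT B \<in> set v"
    then show "P B" using less.IH[of B] v prods_nonterms(3)[OF G v] by (auto simp: prod_rel_def)
  qed
qed

lemma prods_functional:
  assumes "is_slp G" "(A, v) \<in> prods G" "(A, v') \<in> prods G"
  shows "v = v'"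
  using assms prods_nonterms(1)[OF assms(1,2)] unfolding is_slp_def by blast

lemma slp_size_eq_sum:
  assumes G: "is_slp G" and f: "\<And>A. A \<in> nonterms G \<Longrightarrow> (A, f A) \<in> prods G"
  shows "slp_size G = (\<Sum>A \<in> nonterms G. length (f A))"
proof -
  have "prods G = (\<lambda>A. (A, f A)) ` nonterms G"
    using f prods_functional[OF G _ f] prods_nonterms(1)[OF G] by (auto simp: image_iff)
  then show ?thesis by (simp add: slp_size_def sum.reindex inj_on_def)
qed

section \<open>Factors of a fixed length in a word given by a program\<close>

definition factors_of_length :: "nat \<Rightarrow> 'a list \<Rightarrow> 'a list set" where
  "factors_of_length k w = {u. length u = k \<and> (\<exists>p s. w = p @ u @ s)}"

lemma append_factor_split:
  assumes "x @ y = p @ u @ s"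
  shows "(\<exists>s'. x = p @ u @ s') \<or> (\<exists>p'. y = p' @ u @ s) \<or>
    (length p < length x \<and> length x < length p + length u)"
proof -
  consider "length p + length u \<le> length x" | "length x \<le> length p"
    | "length p < length x" "length x < length p + length u" by linarith
  then show ?thesis
  proof cases
    case 1
    have "x = take (length x) ((p @ u) @ s)" using assms by (metis append.assoc append_eq_conv_conj)
    also have "\<dots> = (p @ u) @ take (length x - length (p @ u)) s" using 1 by simp
    finally show ?thesis by auto
  next
    case 2
    have "y = drop (length x) (p @ u @ s)" using assms by (metis append_eq_conv_conj)
    also have "\<dots> = drop (length x) p @ u @ s" using 2 by simp
    finally show ?thesis by blast
  qed blast
qed

text \<open>A factor that lies in no single nonterminal value is pinned down by the symbol
  \<open>i\<close> in which it starts and the number \<open>d\<close> of its letters up to the end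
  of that symbol.\<close>

lemma sym_val_factor:
  assumes "sym_val G v = p @ u @ s" "u \<noteq> []"
  shows "(\<exists>B p' s'. NT B \<in> set v \<and> nonterm_val G B = p' @ u @ s') \<or>
    (\<exists>i < length v. \<exists>d \<in> {1..length u}.
       d \<le> length (sym_val G (take (Suc i) v)) \<and>
       u = take (length u) (drop (length (sym_val G (take (Suc i) v)) - d) (sym_val G v)))"
  using assms(1)
proof (induction v arbitrary: p)
  case Nil
  then show ?case using assms(2) by simp
next
  case (Cons c v)
  let ?x = "sym_val G [c]"
  have xv: "sym_val G (c # v) = ?x @ sym_val G v" by (simp add: sym_val_def)
  have here: ?case if "length p < length ?x" "length ?x \<le> length p + length u"
  proof -
    have "u = take (length u) (drop (length p) (sym_val G (c # v)))"
      unfolding Cons.prems by simp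
    then have "u = take (length u) (drop (length (sym_val G (take (Suc 0) (c # v))) -
        (length ?x - length p)) (sym_val G (c # v)))"
      using that(1) by simp
    moreover have "length ?x - length p \<in> {1..length u}"
      using that by (simp add: Suc_le_eq le_diff_conv add.commute)
    ultimately show ?thesis
      by (intro disjI2 exI[of _ 0] conjI bexI[of _ "length ?x - length p"]) simp_all
  qed
  consider (1) s' where "?x = p @ u @ s'" | (2) p' where "sym_val G v = p' @ u @ s"
    | (3) "length p < length ?x \<and> length ?x < length p + length u"
    using append_factor_split[of ?x "sym_val G v" p u s] Cons.prems xv by fastforce
  then show ?case
  proof cases
    case 1
    show ?thesis
    proof (cases c)
      case (NT B)
      then show ?thesis using 1 by auto
    next
      case (T a)
      then have "length ?x = 1" by simp
      moreover have "length ?x = length p + length u + length s'" using 1 by simp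
      moreover have "length u > 0" using assms(2) by simp
      ultimately have "length p < length ?x" "length ?x \<le> length p + length u" by linarith+
      then show ?thesis by (rule here)
    qed
  next
    case 2
    from Cons.IH[OF 2] show ?thesis
    proof (elim disjE exE bexE conjE)
      fix B p' s' assume "NT B \<in> set v" "nonterm_val G B = p' @ u @ s'"
      then show ?thesis by auto
    next
      fix i d assume i: "i < length v" and d: "d \<in> {1..length u}"
        and L: "d \<le> length (sym_val G (take (Suc i) v))"
        and u: "u = take (length u) (drop (length (sym_val G (take (Suc i) v)) - d) (sym_val G v))"
      let ?L = "length (sym_val G (take (Suc i) v))"
      \<comment> \<open>\<open>L\<close> rules out truncated subtraction, so prepending
        \<open>c\<close> shifts the offset by exactly the length of its value.\<close>
      have "length (sym_val G (take (Suc (Suc i)) (c # v))) - d = length ?x + (?L - d)"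
        using L by (cases c) simp_all
      then have "u = take (length u)
          (drop (length (sym_val G (take (Suc (Suc i)) (c # v))) - d) (sym_val G (c # v)))"
        using u unfolding xv by simp
      moreover have "d \<le> length (sym_val G (take (Suc (Suc i)) (c # v)))"
        using L by (cases c) simp_all
      ultimately show ?thesis using i d by (intro disjI2 exI[of _ "Suc i"]) auto
    qed
  next
    case 3
    then show ?thesis by (intro here) auto
  qed
qed


text \<open>Descending into nonterminals whose values contain the factor must stop, by acyclicity,
  at a rule where a symbol boundary pins it down.\<close>

lemma nonterm_val_factor:
  assumes G: "is_slp G" and A: "A \<in> nonterms G" and "nonterm_val G A = p @ u @ s" "u \<noteq> []"
  shows "\<exists>(B, v) \<in> prods G. \<exists>i < length v. \<exists>d \<in> {1..length u}.
     u = take (length u) (drop (length (sym_val G (take (Suc i) v)) - d) (sym_val G v))"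
  using G A assms(3)
proof (induction A arbitrary: p s rule: slp_induct)
  case (nonterm A v)
  have "sym_val G v = p @ u @ s"
    using nonterm.prems nonterm_val_prod[OF G nonterm.hyps] by simp
  from sym_val_factor[OF this assms(4)] show ?case
    using nonterm.IH nonterm.hyps by blast
qed

text \<open>There are \<open>slp_size G * k\<close> triples of a rule, a position in it and an
  offset, and they reach every factor.\<close>

lemma card_factors_of_length:
  assumes G: "is_slp G" and k: "k > 0"
  shows "finite (factors_of_length k (slp_val G))"
    and "card (factors_of_length k (slp_val G)) \<le> slp_size G * k"
proof -
  let ?I = "SIGMA q : prods G. {..<length (snd q)} \<times> {1..k}"
  let ?h = "\<lambda>(q, i, d). take k (drop (length (sym_val G (take (Suc i) (snd q))) - d) (sym_val G (snd q)))"
  have fin: "finite (prods G)" and S: "start G \<in> nonterms G" using G by (auto simp: is_slp_def)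
  have sub: "factors_of_length k (slp_val G) \<subseteq> ?h ` ?I"
  proof
    fix u assume "u \<in> factors_of_length k (slp_val G)"
    then obtain p s where u: "length u = k" "nonterm_val G (start G) = p @ u @ s"
      by (auto simp: factors_of_length_def slp_val_def)
    then have "u \<noteq> []" using k by auto
    from nonterm_val_factor[OF G S u(2) this] obtain B v i d where
      "(B, v) \<in> prods G" "i < length v" "d \<in> {1..k}" "u = ?h ((B, v), i, d)"
      unfolding u(1) by auto
    then show "u \<in> ?h ` ?I" by (intro image_eqI[of _ _ "((B, v), i, d)"]) auto
  qed
  have finI: "finite ?I" using fin by simp
  show "finite (factors_of_length k (slp_val G))"
    using sub finI finite_surj by blast
  have "card (factors_of_length k (slp_val G)) \<le> card ?I"
    by (rule surj_card_le[OF finI sub])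
  also have "\<dots> = (\<Sum>q \<in> prods G. length (snd q) * k)"
    using fin by (simp add: card_SigmaI card_cartesian_product)
  also have "\<dots> = slp_size G * k"
    by (simp add: slp_size_def sum_distrib_right case_prod_beta)
  finally show "card (factors_of_length k (slp_val G)) \<le> slp_size G * k" .
qed

text \<open>By acyclicity \<open>A\<close> is not reachable from any symbol of its own rule. So each
  symbol contributes at most the product without \<open>A\<close>, and \<open>length (f A)\<close>
  enters only once.\<close>

lemma length_nonterm_val_le:
  assumes G: "is_slp G" and "A \<in> nonterms G"
    and f: "\<And>B. B \<in> nonterms G \<Longrightarrow> (B, f B) \<in> prods G"
  shows "length (nonterm_val G A) \<le> (\<Prod>B \<in> (prod_rel G)\<^sup>* `` {A}. length (f B))"
  using assms(1,2)
proof (induction A rule: slp_induct)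
  case (nonterm A v)
  let ?R = "\<lambda>A. (prod_rel G)\<^sup>* `` {A}" and ?\<pi> = "\<lambda>X. \<Prod>B \<in> X. length (f B)"
  have A: "A \<in> nonterms G" using prods_nonterms(1)[OF G nonterm.hyps] .
  have fA: "f A = v" using prods_functional[OF G f[OF A] nonterm.hyps] .
  have RN: "?R A \<subseteq> nonterms G"
    using A prod_rel_facts(1)[OF G] by (auto elim: rtranclE)
  have finN: "finite (nonterms G)" using G by (simp add: is_slp_def)
  have fin: "finite (?R A)" using RN finN by (rule finite_subset)
  have pos: "length (f B) \<ge> 1" if "B \<in> ?R A" for B
    using prods_nonterms(2)[OF G f] that RN by (simp add: Suc_le_eq subset_iff)
  have bound: "length (case_sym (nonterm_val G) (\<lambda>a. [a]) c) \<le> ?\<pi> (?R A - {A})"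
    if c: "c \<in> set v" for c
  proof (cases c)
    case (NT B)
    have AB: "(A, B) \<in> prod_rel G" using NT c nonterm.hyps by (auto simp: prod_rel_def)
    have "A \<notin> ?R B"
    proof
      assume "A \<in> ?R B"
      then have "(A, A) \<in> (prod_rel G)\<^sup>+" using AB by (auto intro: rtrancl_into_trancl2)
      then show False using prod_rel_facts(2)[OF G] by (simp add: acyclic_def)
    qed
    then have "?R B \<subseteq> ?R A - {A}" using AB by (auto intro: converse_rtrancl_into_rtrancl)
    then have "?\<pi> (?R B) dvd ?\<pi> (?R A - {A})"
      using fin by (intro prod_dvd_prod_subset) auto
    moreover have "?\<pi> (?R A - {A}) > 0" using pos by (intro prod_pos) fastforce
    ultimately have "?\<pi> (?R B) \<le> ?\<pi> (?R A - {A})" by (rule dvd_imp_le)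
    then show ?thesis using nonterm.IH[of B] NT c by simp
  next
    case (T a)
    have "1 \<le> ?\<pi> (?R A - {A})" using pos by (intro prod_ge_1) auto
    then show ?thesis using T by simp
  qed
  have "length (nonterm_val G A) = (\<Sum>c \<leftarrow> v. length (case_sym (nonterm_val G) (\<lambda>a. [a]) c))"
    unfolding nonterm_val_prod[OF G nonterm.hyps] sym_val_def by (simp add: length_concat o_def)
  also have "\<dots> \<le> (\<Sum>c \<leftarrow> v. ?\<pi> (?R A - {A}))"
    using bound by (rule sum_list_mono)
  also have "\<dots> = length (f A) * ?\<pi> (?R A - {A})"
    by (simp add: fA sum_list_triv)
  also have "\<dots> = ?\<pi> (?R A)"
    using fin by (subst (2) prod.remove[of _ A]) auto
  finally show ?case .
qed

text \<open>The crude estimate \<open>x \<le> 2 ^ x\<close> for each right-hand side turns the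
  product into a power of the size.\<close>

lemma length_slp_val_le:
  assumes G: "is_slp G"
  shows "length (slp_val G) \<le> 2 ^ slp_size G"
proof -
  have "\<forall>B \<in> nonterms G. \<exists>v. (B, v) \<in> prods G" using G unfolding is_slp_def by blast
  then obtain f where f: "\<And>B. B \<in> nonterms G \<Longrightarrow> (B, f B) \<in> prods G" by metis
  let ?R = "(prod_rel G)\<^sup>* `` {start G}"
  have S: "start G \<in> nonterms G" and finN: "finite (nonterms G)" using G by (auto simp: is_slp_def)
  have RN: "?R \<subseteq> nonterms G"
    using S prod_rel_facts(1)[OF G] by (auto elim: rtranclE)
  have "length (slp_val G) \<le> (\<Prod>B \<in> ?R. length (f B))"
    unfolding slp_val_def by (rule length_nonterm_val_le[OF G S f])
  also have "\<dots> \<le> (\<Prod>B \<in> ?R. 2 ^ length (f B))"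
    by (rule prod_mono) (simp add: less_imp_le)
  also have "\<dots> = 2 ^ (\<Sum>B \<in> ?R. length (f B))"
    by (simp add: power_sum)
  also have "\<dots> \<le> 2 ^ (\<Sum>B \<in> nonterms G. length (f B))"
    using RN finN by (intro power_increasing sum_mono2) auto
  also have "(\<Sum>B \<in> nonterms G. length (f B)) = slp_size G"
    by (rule slp_size_eq_sum[OF G f, symmetric])
  finally show ?thesis .
qed

section \<open>Constructing straight-line programs\<close>

text \<open>Programs without names for nonterminals: \<open>S\<close> holds the words computed so
  far, single letters are free, and the number is the total length of the right-hand sides. Small
  programs can thus be assembled word by word.\<close>

inductive sl_computes :: "'a list set \<Rightarrow> nat \<Rightarrow> bool" where
  empty: "sl_computes {} 0"
| step: "\<lbrakk>sl_computes S c; us \<noteq> []; \<And>u. u \<in> set us \<Longrightarrow> u \<in> S \<or> length u = 1\<rbrakk> \<Longrightarrow>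
    sl_computes (insert (concat us) S) (c + length us)"

text \<open>Rules are numbered in order of creation, so they refer only to smaller numbers. A word
  computed twice gets two numbers, so \<open>val\<close> need not be injective.\<close>

lemma sl_computes_rules:
  assumes "sl_computes (S :: 'a list set) c"
  shows "\<exists>n (p :: nat \<Rightarrow> (nat, 'a) sym list) val.
    S = val ` {..<n} \<and> c = (\<Sum>i<n. length (p i)) \<and>
    (\<forall>i<n. p i \<noteq> [] \<and> (\<forall>j. NT j \<in> set (p i) \<longrightarrow> j < i) \<and>
       val i = concat (map (case_sym val (\<lambda>a. [a])) (p i)))"
  using assms
proof induction
  case empty
  show ?case by (intro exI[of _ 0]) simp
next
  case (step S c us)
  then obtain n and p :: "nat \<Rightarrow> (nat, 'a) sym list" and val where
    S: "S = val ` {..<n}" and c: "c = (\<Sum>i<n. length (p i))"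
    and p: "\<And>i. i < n \<Longrightarrow> p i \<noteq> []" "\<And>i j. i < n \<Longrightarrow> NT j \<in> set (p i) \<Longrightarrow> j < i"
    and val: "\<And>i. i < n \<Longrightarrow> val i = concat (map (case_sym val (\<lambda>a. [a])) (p i))"
    by blast
  have "\<exists>s. case_sym val (\<lambda>a. [a]) s = u \<and> (\<forall>j. s = NT j \<longrightarrow> j < n)" if "u \<in> set us" for u
    using step.hyps(3)[OF that]
  proof
    assume "u \<in> S"
    then obtain j where "j < n" "u = val j" using S by blast
    then show ?thesis by (intro exI[of _ "NT j"]) simp
  next
    assume "length u = 1"
    then obtain a where "u = [a]" by (auto simp: length_Suc_conv)
    then show ?thesis by (intro exI[of _ "T a"]) simp
  qed
  then obtain s where s: "\<And>u. u \<in> set us \<Longrightarrow> case_sym val (\<lambda>a. [a]) (s u) = u"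
    "\<And>u j. u \<in> set us \<Longrightarrow> s u = NT j \<Longrightarrow> j < n"
    by metis
  let ?p = "p(n := map s us)" and ?val = "val(n := concat us)"
  \<comment> \<open>The update at \<open>n\<close> is invisible to right-hand sides that mention
    only older numbers.\<close>
  have upd: "concat (map (case_sym ?val (\<lambda>a. [a])) v) = concat (map (case_sym val (\<lambda>a. [a])) v)"
    if "\<And>j. NT j \<in> set v \<Longrightarrow> j < n" for v
  proof -
    have "case_sym ?val (\<lambda>a. [a]) x = case_sym val (\<lambda>a. [a]) x" if "x \<in> set v" for x
      using that \<open>\<And>j. NT j \<in> set v \<Longrightarrow> j < n\<close> by (auto split: sym.split)
    then show ?thesis by (simp cong: map_cong)
  qed
  have new: "NT j \<in> set (map s us) \<Longrightarrow> j < n" for j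
    using s(2) by auto
  have "map (case_sym val (\<lambda>a. [a])) (map s us) = us"
    using s(1) by (simp add: map_idI)
  then have 1: "concat (map (case_sym ?val (\<lambda>a. [a])) (map s us)) = concat us"
    by (subst upd[OF new]) simp_all
  have 2: "concat (map (case_sym ?val (\<lambda>a. [a])) (p i)) = val i" if "i < n" for i
    by (subst upd) (use p(2)[OF that] val[OF that] that in \<open>auto dest: order.strict_trans\<close>)
  show ?case
  proof (rule exI[of _ "Suc n"], rule exI[of _ ?p], rule exI[of _ ?val], intro conjI allI impI)
    show "insert (concat us) S = ?val ` {..<Suc n}"
      unfolding S lessThan_Suc by auto
    show "c + length us = (\<Sum>i<Suc n. length (?p i))"
      unfolding c by simp
    fix i assume "i < Suc n"
    then consider "i = n" | "i < n" by linarith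
    note i = this
    show "?p i \<noteq> []" using i p(1) step.hyps(2) by cases auto
    show "?val i = concat (map (case_sym ?val (\<lambda>a. [a])) (?p i))"
      using i 1 2[of i] by cases (auto simp del: map_map)
    fix j assume "NT j \<in> set (?p i)"
    with i show "j < i"
    proof cases
      case 1
      then show ?thesis using \<open>NT j \<in> set (?p i)\<close> new[of j] by simp
    next
      case 2
      then show ?thesis using \<open>NT j \<in> set (?p i)\<close> p(2)[of i j] by simp
    qed
  qed
qed

text \<open>All numbered rules are kept, a number with value \<open>w\<close> becomes the start, and
  decreasing numbers give acyclicity.\<close>

lemma smallest_slp_size_le:
  assumes "sl_computes S c" "w \<in> S"
  shows "smallest_slp_size w \<le> c"
proof -
  obtain n and p :: "nat \<Rightarrow> (nat, 'a) sym list" and val where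
    S: "S = val ` {..<n}" and c: "c = (\<Sum>i<n. length (p i))"
    and p: "\<And>i. i < n \<Longrightarrow> p i \<noteq> []" "\<And>i j. i < n \<Longrightarrow> NT j \<in> set (p i) \<Longrightarrow> j < i"
    and val: "\<And>i. i < n \<Longrightarrow> val i = concat (map (case_sym val (\<lambda>a. [a])) (p i))"
    using sl_computes_rules[OF assms(1)] by blast
  obtain i0 where i0: "i0 < n" "w = val i0" using assms(2) S by blast
  define G :: "(nat, 'a) slp" where
    "G = \<lparr>nonterms = {..<n}, alphabet = (\<Union>i<n. {a. T a \<in> set (p i)}),
      prods = (\<lambda>i. (i, p i)) ` {..<n}, start = i0\<rparr>"
  have finT: "finite {a. T a \<in> set v}" for v :: "(nat, 'a) sym list"
  proof -
    have "{a. T a \<in> set v} \<subseteq> (\<lambda>s. case s of T a \<Rightarrow> a) ` set v" by force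
    then show ?thesis by (rule finite_subset) simp
  qed
  have "acyclic {(A, B). \<exists>v. (A, v) \<in> prods G \<and> NT B \<in> set v}" (is "acyclic ?E")
  proof -
    have "?E\<inverse> \<subseteq> measure id" using p(2) by (auto simp: G_def)
    then have "wf (?E\<inverse>)" by (rule wf_subset[OF wf_measure])
    from wf_acyclic[OF this] show ?thesis by (simp only: acyclic_converse)
  qed
  moreover have "set (p i) \<subseteq> NT ` nonterms G \<union> T ` alphabet G" if "i < n" for i
  proof
    fix x assume x: "x \<in> set (p i)"
    show "x \<in> NT ` nonterms G \<union> T ` alphabet G"
    proof (cases x)
      case (NT j)
      then have "j < n" using x p(2)[of i j] that by simp
      then show ?thesis using NT by (simp add: G_def)
    next
      case (T a)
      then show ?thesis using x that by (auto simp: G_def)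
    qed
  qed
  ultimately have G: "is_slp G"
    unfolding is_slp_def using i0 p(1) finT by (auto simp: G_def)
  have "derives G [NT i] (map T (val i))" if "i < n" for i
    using that
  proof (induction i rule: less_induct)
    case (less i)
    have "(i, p i) \<in> prods G" using less.prems by (simp add: G_def)
    moreover have "derives G (p i) (map T (val i))"
      unfolding val[OF less.prems]
      by (rule derives_symbols) (use less p(2)[of i] in force)
    ultimately show ?case by (rule derives_prod)
  qed
  then have "slp_val G = w"
    unfolding slp_val_def using i0 by (intro nonterm_val_eqI[OF G]) (simp_all add: G_def)
  moreover have "slp_size G = c"
    by (simp add: slp_size_def G_def c sum.reindex inj_on_def)
  ultimately show ?thesis
    unfolding smallest_slp_size_def using G by (intro Least_le) blast
qed

lemma smallest_slp_size_le_length: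
  assumes "w \<noteq> []"
  shows "smallest_slp_size w \<le> length w"
proof -
  have "sl_computes (insert (concat (map (\<lambda>a. [a]) w)) {}) (0 + length (map (\<lambda>a. [a]) w))"
    by (rule sl_computes.intros) (use assms in \<open>auto intro: sl_computes.intros\<close>)
  then show ?thesis using smallest_slp_size_le[of _ _ w] by simp
qed

text \<open>The minimum is attained because \<open>lz78 w\<close> is one program for
  \<open>w\<close>.\<close>

lemma smallest_slp:
  assumes "w \<noteq> []"
  obtains G :: "(nat, 'a) slp" where "is_slp G" "slp_val G = w" "slp_size G = smallest_slp_size w"
proof -
  have "\<exists>m. \<exists>G :: (nat, 'a) slp. is_slp G \<and> slp_val G = w \<and> slp_size G = m"
    using lz78_is_slp_val[OF assms] by blast
  from LeastI_ex[OF this] show ?thesis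
    using that unfolding smallest_slp_size_def[symmetric] by blast
qed

text \<open>Repeated squaring: each binary digit of \<open>r\<close> costs one rule of at most three
  symbols, two copies of the half power and possibly one more \<open>u\<close>.\<close>

lemma sl_computes_power:
  assumes "sl_computes S c" "u \<in> S \<or> length u = 1" "1 \<le> r" "r < 2 ^ e"
  obtains S' c' where "sl_computes S' c'" "c' \<le> c + 3 * e" "S \<subseteq> S'" "concat (replicate r u) \<in> S'"
proof -
  have "\<exists>S' c'. sl_computes S' c' \<and> c' \<le> c + 3 * e \<and> S \<subseteq> S' \<and> concat (replicate r u) \<in> S'"
    using assms(3,4)
  proof (induction e arbitrary: r)
    case 0
    then show ?case by simp
  next
    case (Suc e)
    show ?case
    proof (cases "r = 1")
      case True
      have "sl_computes (insert (concat [u]) S) (c + length [u])"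
        using assms(1,2) by (intro sl_computes.step) auto
      then show ?thesis using True by (intro exI conjI) auto
    next
      case False
      define q where "q = r div 2"
      have "1 \<le> q" "q < 2 ^ e" using False Suc.prems by (auto simp: q_def)
      from Suc.IH[OF this] obtain S1 c1 where
        S1: "sl_computes S1 c1" "c1 \<le> c + 3 * e" "S \<subseteq> S1" "concat (replicate q u) \<in> S1" by blast
      let ?U = "concat (replicate q u)"
      define us where "us = [?U, ?U] @ (if even r then [] else [u])"
      have r: "r = q + q + (if even r then 0 else 1)" unfolding q_def by presburger
      have "concat us = concat (replicate r u)"
        by (subst r) (simp add: us_def replicate_add)
      moreover have "sl_computes (insert (concat us) S1) (c1 + length us)"
        using S1 assms(2) by (intro sl_computes.step) (auto simp: us_def split: if_splits)
      moreover have "length us \<le> 3" by (simp add: us_def)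
      ultimately show ?thesis using S1
        by (intro exI[of _ "insert (concat us) S1"] exI[of _ "c1 + length us"]) auto
    qed
  qed
  then show ?thesis using that by blast
qed

lemma sl_computes_run:
  assumes "sl_computes S c" "1 \<le> r" "r < 2 ^ e"
  obtains S' c' where "sl_computes S' c'" "c' \<le> c + 3 * e" "S \<subseteq> S'" "replicate r a \<in> S'"
proof -
  have "concat (replicate r [a]) = replicate r a" by (induction r) simp_all
  then show ?thesis
    using sl_computes_power[OF assms(1) _ assms(2,3), of "[a]"] that by auto
qed

lemma sl_computes_runs:
  assumes "sl_computes S c"
  obtains S' c' where "sl_computes S' c'" "c' \<le> c + 2 * m" "S \<subseteq> S'"
    "\<And>t. t < m \<Longrightarrow> replicate (Suc t) a \<in> S'"
proof -
  have "\<exists>S' c'. sl_computes S' c' \<and> c' \<le> c + 2 * m \<and> S \<subseteq> S' \<and> (\<forall>t<m. replicate (Suc t) a \<in> S')"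
  proof (induction m)
    case 0
    show ?case using assms by (intro exI[of _ S] exI[of _ c]) simp
  next
    case (Suc m)
    then obtain S1 c1 where S1: "sl_computes S1 c1" "c1 \<le> c + 2 * m" "S \<subseteq> S1"
      "\<forall>t<m. replicate (Suc t) a \<in> S1" by blast
    define us where "us = (if m = 0 then [[a]] else [[a], replicate m a])"
    have "replicate m a \<in> S1" if "m \<noteq> 0"
      using S1(4) that by (cases m) auto
    then have "sl_computes (insert (concat us) S1) (c1 + length us)"
      using S1(1) by (intro sl_computes.step) (auto simp: us_def split: if_splits)
    moreover have "concat us = replicate (Suc m) a" by (simp add: us_def)
    moreover have "length us \<le> 2" by (simp add: us_def)
    ultimately show ?case using S1
      by (intro exI[of _ "insert (concat us) S1"] exI[of _ "c1 + length us"])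
         (auto simp: less_Suc_eq simp del: replicate_Suc)
  qed
  then show ?thesis using that by blast
qed

section \<open>LZ78 as a rotor walk\<close>

definition separated :: "'a \<Rightarrow> (nat \<Rightarrow> 'a list) \<Rightarrow> nat \<times> nat \<times> nat \<Rightarrow> 'a list" where
  "separated a c = (\<lambda>(x, t, y). replicate x a @ c t @ replicate y a)"

definition periodic :: "'a \<Rightarrow> (nat \<Rightarrow> 'a list) \<Rightarrow> nat \<Rightarrow> nat \<Rightarrow> 'a list" where
  "periodic a c m K = concat (map (\<lambda>t. c t @ replicate K a) [0..<m])"

lemma concat_periodic:
  assumes "m > 0"
  shows "concat (map (\<lambda>i. c (i mod m) @ replicate K a) [0..<m * N]) =
    concat (replicate N (periodic a c m K))"
proof (induction N)
  case (Suc N)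
  have "[0..<m * Suc N] = [0..<m * N] @ map (\<lambda>t. t + m * N) [0..<m]"
    using upt_add_eq_append[of 0 "m * N" m] map_add_upt[of "m * N" m]
    by (simp add: add.commute)
  moreover have "concat (map (\<lambda>t. c (t mod m) @ replicate K a) [0..<m]) = periodic a c m K"
    unfolding periodic_def by (rule arg_cong[of _ _ concat], rule map_cong) auto
  ultimately have "concat (map (\<lambda>i. c (i mod m) @ replicate K a) [0..<m * Suc N]) =
      concat (replicate N (periodic a c m K) @ [periodic a c m K])"
    using Suc by (simp add: o_def)
  then show ?case by (simp add: replicate_append_same)
qed simp

lemma card_filter_insert:
  assumes "finite E" "e \<notin> E"
  shows "card {x \<in> insert e E. P x} = card {x \<in> E. P x} + of_bool (P e)"
proof (cases "P e")
  case True
  then have "{x \<in> insert e E. P x} = insert e {x \<in> E. P x}" by auto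
  then show ?thesis using assms True by simp
next
  case False
  then have "{x \<in> insert e E. P x} = {x \<in> E. P x}" by auto
  then show ?thesis using False by simp
qed

section \<open>The Eulerian graph of the rotor walk\<close>

definition edges :: "nat \<Rightarrow> nat \<Rightarrow> (nat \<times> nat \<times> nat) set" where
  "edges m K = {..K} \<times> {..<m} \<times> {..K}"

fun tail :: "nat \<times> nat \<times> nat \<Rightarrow> nat \<times> nat" where
  "tail (x, t, y) = (x, t)"

fun head :: "nat \<Rightarrow> nat \<Rightarrow> nat \<times> nat \<times> nat \<Rightarrow> nat \<times> nat" where
  "head m K (x, t, y) = (K - y, Suc t mod m)"

text \<open>Every vertex has \<open>Suc K\<close> incoming edges, as many as outgoing ones. Those
  into a vertex \<open>(0, t)\<close> have last component \<open>K\<close>, so a rotor uses them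
  last.\<close>

lemma in_edges:
  assumes "x \<le> K" "t < m"
  shows "{e \<in> edges m K. head m K e = (x, Suc t mod m)} = (\<lambda>x'. (x', t, K - x)) ` {..K}"
proof -
  have "t' = t" if "t' < m" "Suc t' mod m = Suc t mod m" for t'
    using that assms(2) by (auto simp: mod_Suc split: if_splits)
  then show ?thesis using assms by (force simp: edges_def)
qed

lemma card_in_edges:
  assumes "x \<le> K" "t < m"
  shows "card {e \<in> edges m K. head m K e = (x, Suc t mod m)} = Suc K"
  unfolding in_edges[OF assms] by (simp add: card_image inj_on_def)

lemma out_edges:
  assumes "x \<le> K" "t < m"
  shows "{e \<in> edges m K. tail e = (x, t)} = (\<lambda>y. (x, t, y)) ` {..K}"
  using assms by (auto simp: edges_def)

lemma card_out_edges:
  assumes "x \<le> K" "t < m"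
  shows "card {e \<in> edges m K. tail e = (x, t)} = Suc K"
  unfolding out_edges[OF assms] by (simp add: card_image inj_on_def)

text \<open>
  A rotor walk that has used the edges \<open>E\<close> and stands at \<open>u\<close> gets stuck only after using
  every edge: it can only be stuck at its origin, so all edges into the origin are used; as
  every rotor reaches the vertices \<open>(0, t)\<close> last, this propagates backwards around the cycle.
\<close>

lemma rotor_walk_not_stuck:
  assumes E: "E \<subseteq> edges m K"
    and down: "\<And>x t y y'. (x, t, y) \<in> E \<Longrightarrow> y' \<le> y \<Longrightarrow> (x, t, y') \<in> E"
    and bal: "\<And>v. card {e \<in> E. tail e = v} + of_bool (v = u) =
      card {e \<in> E. head m K e = v} + of_bool (v = (0, 0))"
    and u: "u = (x, t)" "x \<le> K" "t < m"
    and stuck: "\<And>y. y \<le> K \<Longrightarrow> (x, t, y) \<in> E"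
  shows "E = edges m K"
proof -
  have fin: "finite (edges m K)" by (simp add: edges_def)
  have m: "m > 0" using u(3) by simp
  have in_le: "card {e \<in> E. head m K e = (x', Suc t' mod m)} \<le> Suc K" if "x' \<le> K" "t' < m" for x' t'
    unfolding card_in_edges[OF that, symmetric] using E fin by (intro card_mono) auto
  \<comment> \<open>Once every edge with last component \<open>K\<close> out of a layer is used,
    \<open>down\<close> supplies the others.\<close>
  have in_full: "(x', t', y) \<in> E"
    if "card {e \<in> E. head m K e = (0, Suc t' mod m)} = Suc K" "t' < m" "x' \<le> K" "y \<le> K" for x' t' y
  proof -
    have "{e \<in> E. head m K e = (0, Suc t' mod m)} = {e \<in> edges m K. head m K e = (0, Suc t' mod m)}"
      using E fin that(1,2) card_in_edges[of 0 K t' m] by (intro card_subset_eq) auto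
    then have "(x', t', K) \<in> E"
      unfolding in_edges[OF le0 that(2)] using that(3) by auto
    then show ?thesis using down that(4) by blast
  qed
  have out_full: "card {e \<in> E. tail e = (x', t')} = Suc K"
    if "\<And>y. y \<le> K \<Longrightarrow> (x', t', y) \<in> E" "x' \<le> K" "t' < m" for x' t'
  proof -
    have "{e \<in> E. tail e = (x', t')} = {e \<in> edges m K. tail e = (x', t')}"
      using E that(1) out_edges[OF that(2,3)] by auto
    then show ?thesis using card_out_edges[OF that(2,3)] by simp
  qed
  have pred: "\<exists>s<m. t' = Suc s mod m" if "t' < m" for t'
    using that m by (cases t') (auto intro: exI[of _ "m - 1"] exI[of _ "t' - 1"])
  obtain s where s: "s < m" "t = Suc s mod m" using pred[OF u(3)] by blast
  \<comment> \<open>All \<open>Suc K\<close> edges out of \<open>u\<close> are used and one more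
    visit is pending, but at most \<open>Suc K\<close> edges enter \<open>u\<close>. So the balance
    forces \<open>u\<close> to be the origin, with all incoming edges used.\<close>
  have "Suc K + 1 = card {e \<in> E. head m K e = u} + of_bool (u = (0, 0))"
    using bal[of u] out_full[OF stuck u(2,3)] u(1) by simp
  moreover have "card {e \<in> E. head m K e = u} \<le> Suc K"
    using in_le[OF u(2) s(1)] u(1) s(2) by simp
  ultimately have u0: "u = (0, 0)" and in0: "card {e \<in> E. head m K e = (0, 0)} = Suc K"
    by (auto simp: of_bool_def split: if_splits)
  \<comment> \<open>Backwards around the cycle: \<open>d = 0\<close> is the layer whose edges lead
    into layer 0.\<close>
  have all: "\<forall>x' \<le> K. \<forall>y \<le> K. (x', m - Suc d, y) \<in> E" if "d < m" for d
    using that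
  proof (induction d)
    case 0
    have "Suc (m - 1) mod m = 0" using m by simp
    then show ?case using in_full[of "m - 1"] in0 m by simp
  next
    case (Suc d)
    define t' where "t' = m - Suc (Suc d)"
    have t': "Suc t' mod m = m - Suc d" "t' < m" "m - Suc d < m" "m - Suc d \<noteq> 0"
      using Suc.prems by (auto simp: t'_def)
    have "card {e \<in> E. tail e = (0, m - Suc d)} = Suc K"
      by (rule out_full) (use Suc t' in auto)
    then have "card {e \<in> E. head m K e = (0, Suc t' mod m)} = Suc K"
      using bal[of "(0, m - Suc d)"] u0 t' by simp
    then show ?case using in_full[of t'] t'(2) unfolding t'_def by blast
  qed
  have "edges m K \<subseteq> E"
  proof
    fix e assume "e \<in> edges m K"
    then obtain x' t' y where e: "e = (x', t', y)" "x' \<le> K" "t' < m" "y \<le> K"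
      by (auto simp: edges_def)
    have "m - Suc (m - Suc t') = t'" "m - Suc t' < m" using e(3) by auto
    then show "e \<in> E" using all[of "m - Suc t'"] e by simp
  qed
  then show ?thesis using E by blast
qed

text \<open>
  The edge \<open>(x, t, y)\<close> is the phrase \<open>a\<^sup>x c\<^sub>t a\<^sup>y\<close>, read when \<open>x\<close> letters \<open>a\<close> are left before
  the separator \<open>c\<^sub>t\<close>; it leaves \<open>K - y\<close> letters before the next separator.
\<close>

lemma lz78_parse_walk:
  assumes D: "lz78_dict D" and m: "m > 0"
    and inj: "inj_on (separated a c) (edges m K)"
    and ne: "\<And>t. t < m \<Longrightarrow> c t \<noteq> []"
    and pre: "\<And>x t. x \<le> K \<Longrightarrow> t < m \<Longrightarrow> replicate x a @ butlast (c t) \<in> set ([] # D)"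
    and new: "\<And>e. e \<in> edges m K \<Longrightarrow> separated a c e \<notin> set ([] # D)"
    and j: "j \<le> card (edges m K)"
  shows "\<exists>F x E. lz78_dict (D @ F) \<and> E \<subseteq> edges m K \<and> set F = separated a c ` E \<and>
    card E = j \<and> x \<le> K \<and>
    (\<forall>v. card {e \<in> E. tail e = v} + of_bool (v = (x, j mod m)) =
      card {e \<in> E. head m K e = v} + of_bool (v = (0, 0))) \<and>
    concat F @ replicate x a = concat (map (\<lambda>i. c (i mod m) @ replicate K a) [0..<j])"
  using j
proof (induction j)
  case 0
  show ?case using D by (intro exI[of _ "[]"] exI[of _ 0] exI[of _ "{}"]) simp
next
  case (Suc j)
  let ?P = "separated a c"
  \<comment> \<open>\<open>F\<close> lists the phrases read, \<open>E\<close> the edges used, and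
    \<open>x\<close> counts the letters left over; \<open>bal\<close> is flow conservation for a
    walk that starts at \<open>(0, 0)\<close>.\<close>
  from Suc obtain F x E where dict: "lz78_dict (D @ F)" and E: "E \<subseteq> edges m K"
    and F: "set F = ?P ` E" and card: "card E = j" and x: "x \<le> K"
    and bal: "\<And>v. card {e \<in> E. tail e = v} + of_bool (v = (x, j mod m)) =
      card {e \<in> E. head m K e = v} + of_bool (v = (0, 0))"
    and con: "concat F @ replicate x a = concat (map (\<lambda>i. c (i mod m) @ replicate K a) [0..<j])"
    by auto
  define t where "t = j mod m"
  have t: "t < m" using m by (simp add: t_def)
  have fin: "finite E" using E by (rule finite_subset) (simp add: edges_def)
  have mem: "?P e \<in> set ([] # D @ F) \<longleftrightarrow> e \<in> E" if "e \<in> edges m K" for e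
    using new[OF that] F inj E that by (auto simp: inj_on_image_mem_iff)
  \<comment> \<open>The dictionary is prefix-closed, so each vertex uses its edges in increasing
    order of the last component.\<close>
  have down: "(x', t', y') \<in> E" if "(x', t', y) \<in> E" "y' \<le> y" for x' t' y y'
  proof -
    have e: "(x', t', y) \<in> edges m K" using that(1) E by blast
    have "?P (x', t', y) = ?P (x', t', y') @ replicate (y - y') a"
      using that(2) by (simp add: separated_def flip: replicate_add)
    then have "?P (x', t', y') \<in> set ([] # D @ F)"
      using lz78_dict_prefix[OF dict] mem[OF e] that(1) by metis
    moreover have "(x', t', y') \<in> edges m K" using e that(2) by (auto simp: edges_def)
    ultimately show ?thesis using mem by blast
  qed
  have "\<exists>y. y \<le> K \<and> (x, t, y) \<notin> E"
  proof (rule ccontr)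
    assume "\<not> (\<exists>y. y \<le> K \<and> (x, t, y) \<notin> E)"
    then have "E = edges m K"
      by (intro rotor_walk_not_stuck[OF E down bal refl x]) (use t in \<open>auto simp: t_def\<close>)
    then show False using card Suc.prems by simp
  qed
  then obtain y0 where y0: "y0 \<le> K" "(x, t, y0) \<notin> E" by blast
  define y where "y = (LEAST y. (x, t, y) \<notin> E)"
  have y: "y \<le> K" "(x, t, y) \<notin> E"
    using y0 LeastI[of "\<lambda>y. (x, t, y) \<notin> E"] Least_le[of "\<lambda>y. (x, t, y) \<notin> E" y0]
    unfolding y_def by auto
  have min: "(x, t, y') \<in> E" if "y' < y" for y'
    using not_less_Least that unfolding y_def by blast
  define e where "e = (x, t, y)"
  have e: "e \<in> edges m K" using x t y by (simp add: e_def edges_def)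
  have eE: "e \<notin> E" using y by (simp add: e_def)
  have "\<exists>d \<in> set ([] # D @ F). \<exists>b. ?P e = d @ [b]"
  proof (cases y)
    case 0
    \<comment> \<open>On a first visit, \<open>pre\<close> guarantees that the phrase is not cut
      inside the separator.\<close>
    have "?P e = (replicate x a @ butlast (c t)) @ [last (c t)]"
      using ne[OF t] 0 by (simp add: e_def separated_def)
    moreover have "replicate x a @ butlast (c t) \<in> set ([] # D @ F)" using pre[OF x t] by auto
    ultimately show ?thesis by blast
  next
    case (Suc y')
    then have "(x, t, y') \<in> E" using min by simp
    then have "?P (x, t, y') \<in> set ([] # D @ F)" using F by auto
    moreover have "?P e = ?P (x, t, y') @ [a]"
      by (simp add: e_def separated_def Suc replicate_append_same)
    ultimately show ?thesis by blast
  qed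
  then have "lz78_dict (D @ (F @ [?P e]))"
    using lz78_dict_snoc[of "D @ F" "?P e"] dict mem[OF e] eE by simp
  moreover have "insert e E \<subseteq> edges m K" using e E by simp
  moreover have "set (F @ [?P e]) = ?P ` insert e E" using F by simp
  moreover have "card (insert e E) = Suc j" using card eE fin by simp
  moreover have "\<forall>v. card {e' \<in> insert e E. tail e' = v} + of_bool (v = (K - y, Suc j mod m)) =
      card {e' \<in> insert e E. head m K e' = v} + of_bool (v = (0, 0))"
  proof
    fix v
    have "tail e = (x, j mod m)" "head m K e = (K - y, Suc j mod m)"
      by (simp_all add: e_def t_def mod_Suc_eq)
    then show "card {e' \<in> insert e E. tail e' = v} + of_bool (v = (K - y, Suc j mod m)) =
      card {e' \<in> insert e E. head m K e' = v} + of_bool (v = (0, 0))"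
      using bal[of v] unfolding card_filter_insert[OF fin eE] by (simp add: eq_commute)
  qed
  moreover have "concat (F @ [?P e]) @ replicate (K - y) a =
      concat (map (\<lambda>i. c (i mod m) @ replicate K a) [0..<Suc j])"
  proof -
    have "concat (F @ [?P e]) @ replicate (K - y) a =
        (concat F @ replicate x a) @ c t @ replicate (y + (K - y)) a"
      by (simp add: e_def separated_def replicate_add)
    then show ?thesis using y(1) by (simp add: con t_def)
  qed
  ultimately show ?case using diff_le_self[of K y] by blast
qed

text \<open>When all edges are used, in- and out-degrees agree everywhere, so the walk is back at
  its origin: no letter is left over, and the last phrase ends with the last period.\<close>

lemma lz78_parse_periodic:
  assumes D: "lz78_dict D" and m: "m > 0"
    and inj: "inj_on (separated a c) (edges m K)"
    and ne: "\<And>t. t < m \<Longrightarrow> c t \<noteq> []"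
    and pre: "\<And>x t. x \<le> K \<Longrightarrow> t < m \<Longrightarrow> replicate x a @ butlast (c t) \<in> set ([] # D)"
    and new: "\<And>e. e \<in> edges m K \<Longrightarrow> separated a c e \<notin> set ([] # D)"
  obtains F where "lz78_dict (D @ F)" "set F = separated a c ` edges m K"
    "concat F = concat (replicate ((Suc K)\<^sup>2) (periodic a c m K))"
proof -
  let ?j = "card (edges m K)"
  \<comment> \<open>Each edge reads one separator, and a period has \<open>m\<close> of them; hence
    the exponent \<open>(Suc K)\<^sup>2\<close>.\<close>
  have cE: "?j = m * (Suc K)\<^sup>2"
    by (simp add: edges_def card_cartesian_product power2_eq_square algebra_simps)
  obtain F x E where F: "lz78_dict (D @ F)" "E \<subseteq> edges m K" "set F = separated a c ` E"
      "card E = ?j" "x \<le> K"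
    and bal: "\<forall>v. card {e \<in> E. tail e = v} + of_bool (v = (x, ?j mod m)) =
      card {e \<in> E. head m K e = v} + of_bool (v = (0, 0))"
    and con: "concat F @ replicate x a = concat (map (\<lambda>i. c (i mod m) @ replicate K a) [0..<?j])"
    using lz78_parse_walk[OF D m inj ne pre new order.refl] by blast
  have E: "E = edges m K"
    using F(2,4) by (intro card_subset_eq) (auto simp: edges_def)
  have "card {e \<in> edges m K. head m K e = (x, 0)} = Suc K"
    using card_in_edges[OF F(5), of "m - 1" m] m by simp
  moreover have "card {e \<in> edges m K. tail e = (x, 0)} = Suc K"
    using card_out_edges[OF F(5) m] .
  ultimately have "x = 0"
    using spec[OF bal, of "(x, 0)"] unfolding E by (simp add: cE of_bool_def split: if_splits)
  then have "concat F = concat (replicate ((Suc K)\<^sup>2) (periodic a c m K))"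
    using con concat_periodic[OF m] by (simp add: cE)
  then show ?thesis using that F(1,3) E by blast
qed

section \<open>The upper bound\<close>

text \<open>The start rule lists the phrases \<open>gs\<close> and possibly the repeated last
  factor; every other rule has at most two symbols.\<close>

lemma lz78_size_bounds:
  assumes w: "w \<noteq> []" "w = concat gs @ g" and gs: "lz78_dict gs" "g \<in> set ([] # gs)"
  shows "length gs \<le> slp_size (lz78 w)" "slp_size (lz78 w) \<le> 3 * length gs + 1"
proof -
  let ?G = "lz78 w" and ?N = "length gs"
  have "is_lz78_factorization w (gs @ [g])"
    using assms unfolding is_lz78_factorization_snoc by blast
  then have fs: "lz78_factorization w = gs @ [g]"
    unfolding lz78_factorization_def using lz78_factorization_ex1 by (rule the1_equality[rotated])
  have G: "is_slp ?G" using lz78_is_slp_val[OF w(1)] by blast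
  have N: "nonterms ?G = {..<Suc ?N}"
    by (simp add: lz78_def fs Let_def)
  have P0: "?N \<le> length v \<and> length v \<le> Suc ?N" if "(0, v) \<in> prods ?G" for v
    using that by (auto simp: lz78_def fs Let_def simp del: upt_Suc)
  have P1: "length v \<le> 2" if "(Suc i, v) \<in> prods ?G" for i v
    using that by (auto simp: lz78_def fs Let_def)
  have "\<forall>B \<in> nonterms ?G. \<exists>v. (B, v) \<in> prods ?G" using G unfolding is_slp_def by blast
  then obtain f where f: "\<And>B. B \<in> nonterms ?G \<Longrightarrow> (B, f B) \<in> prods ?G" by metis
  have size: "slp_size ?G = length (f 0) + (\<Sum>i<?N. length (f (Suc i)))"
    using slp_size_eq_sum[of ?G f] G f by (simp add: N sum.lessThan_Suc_shift del: sum.lessThan_Suc)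
  have "?N \<le> length (f 0) \<and> length (f 0) \<le> Suc ?N" using P0 f N by simp
  moreover have "length (f (Suc i)) \<le> 2" if "i < ?N" for i
    using P1[of i "f (Suc i)"] f[of "Suc i"] N that by simp
  then have "(\<Sum>i<?N. length (f (Suc i))) \<le> ?N * 2"
    using sum_bounded_above[of "{..<?N}" "\<lambda>i. length (f (Suc i))" 2] by simp
  ultimately show "?N \<le> slp_size ?G" "slp_size ?G \<le> 3 * ?N + 1"
    using size by simp_all
qed

text \<open>Short factors are few since \<open>w\<close> has few factors of each length, long ones
  since they occupy disjoint parts of \<open>w\<close>. Multiplying by the threshold
  \<open>q\<close> avoids division.\<close>

lemma card_distinct_factors:
  assumes w: "w \<noteq> []" "w = concat gs @ g" and gs: "distinct gs" "[] \<notin> set gs"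
  shows "q * length gs \<le> smallest_slp_size w * q ^ 3 + length w"
proof -
  let ?F = "\<lambda>j. factors_of_length j w"
  define short long where "short = {u \<in> set gs. length u \<le> q}" and "long = set gs - short"
  obtain G :: "(nat, 'a) slp" where G: "is_slp G" "slp_val G = w" "slp_size G = smallest_slp_size w"
    using smallest_slp[OF w(1)] .
  have F: "finite (?F j)" "card (?F j) \<le> smallest_slp_size w * j" if "j > 0" for j
    using card_factors_of_length[OF G(1) that] G by simp_all
  have "short \<subseteq> (\<Union>j \<in> {1..q}. ?F j)"
  proof
    fix u assume u: "u \<in> short"
    then have "u \<in> set gs" by (simp add: short_def)
    then obtain xs ys where "gs = xs @ u # ys" by (auto simp: in_set_conv_decomp)
    then have "w = concat xs @ u @ (concat ys @ g)" using w(2) by simp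
    then have "u \<in> ?F (length u)" unfolding factors_of_length_def by blast
    moreover have "u \<noteq> []" using u gs(2) by (auto simp: short_def)
    then have "length u \<in> {1..q}" using u by (auto simp: short_def Suc_le_eq)
    ultimately show "u \<in> (\<Union>j \<in> {1..q}. ?F j)" by blast
  qed
  then have "card short \<le> card (\<Union>j \<in> {1..q}. ?F j)"
    using F(1) by (intro card_mono) auto
  also have "\<dots> \<le> (\<Sum>j \<in> {1..q}. card (?F j))" by (rule card_UN_le) simp
  also have "\<dots> \<le> (\<Sum>j \<in> {1..q}. smallest_slp_size w * q)"
    using F(2) by (intro sum_mono) (meson atLeastAtMost_iff le_trans mult_le_mono2 zero_less_one less_le_trans)
  finally have short: "q * card short \<le> smallest_slp_size w * q ^ 3"
    by (simp add: power3_eq_cube algebra_simps)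
  have "q \<le> length u" if "u \<in> long" for u
    using that by (auto simp: long_def short_def)
  then have "q * card long \<le> (\<Sum>u \<in> long. length u)"
    using sum_bounded_below[of long q length] by (simp add: mult.commute)
  also have "\<dots> \<le> (\<Sum>u \<in> set gs. length u)"
    by (rule sum_mono2) (auto simp: long_def)
  also have "\<dots> = length (concat gs)"
    using gs(1) by (simp add: length_concat sum_list_distinct_conv_sum_set)
  also have "\<dots> \<le> length w" using w(2) by simp
  finally have long: "q * card long \<le> length w" .
  have "length gs = card short + card long"
    using card_Un_disjoint[of short long] distinct_card[OF gs(1)]
    by (simp add: long_def short_def Un_absorb1 Collect_restrict)
  then show ?thesis using short long by (simp add: add_mult_distrib2)
qed

text \<open>Weakening base 2 to \<open>exp 1\<close> in the length bound yields \<open>ln\<close>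
  without a constant.\<close>

lemma ln_le_smallest_slp_size:
  assumes "w \<noteq> []"
  shows "ln (length w) \<le> smallest_slp_size w"
proof -
  let ?g = "smallest_slp_size w"
  obtain G :: "(nat, 'a) slp" where "is_slp G" "slp_val G = w" "slp_size G = ?g"
    using smallest_slp[OF assms] .
  then have "length w \<le> 2 ^ ?g" using length_slp_val_le by metis
  then have "real (length w) \<le> 2 ^ ?g" by (metis of_nat_le_iff of_nat_numeral of_nat_power)
  also have "\<dots> \<le> exp 1 ^ ?g" using exp_ge_add_one_self[of 1] by (intro power_mono) auto
  also have "\<dots> = exp ?g" by (simp flip: exp_of_nat_mult)
  finally have "ln (length w) \<le> ln (exp ?g)" using assms by (subst ln_le_cancel_iff) auto
  then show ?thesis by simp
qed

lemma lz78_ratio_upper: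
  assumes len: "length w = n" "n \<ge> 2"
  shows "slp_size (lz78 w) / smallest_slp_size w \<le> 20 * (n / ln n) powr (2 / 3)"
proof -
  let ?g = "real (smallest_slp_size w)"
  have w: "w \<noteq> []" using len by auto
  have "lz78_dict []" by (simp add: lz78_dict_def)
  then obtain gs g where gs: "w = concat gs @ g" "lz78_dict gs" "g \<in> set ([] # gs)"
    using lz78_factors_exist[of "[]" w] by auto
  let ?N = "length gs"
  have "distinct gs" "[] \<notin> set gs" using gs(2) by (auto simp: lz78_dict_def)
  note count = card_distinct_factors[OF w gs(1) this]
  have "gs \<noteq> []" using gs w by auto
  then have "?N \<ge> 1" by (simp add: Suc_le_eq)
  then have size: "slp_size (lz78 w) \<le> 4 * ?N"
    using lz78_size_bounds(2)[OF w gs] by linarith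
  have lnn: "ln n > 0" using len by simp
  have lng: "ln n \<le> ?g" using ln_le_smallest_slp_size[OF w] len by simp
  have g0: "?g > 0" using lnn lng by linarith
  have gn: "?g \<le> n" using smallest_slp_size_le_length[OF w] len by simp
  \<comment> \<open>At \<open>z\<close> the two bounds \<open>?g * z ^ 2\<close> and
    \<open>n / z\<close> coincide; as \<open>z \<ge> 1\<close>, rounding up costs at most a factor
    2.\<close>
  define z where "z = (n / ?g) powr (1 / 3)"
  have z1: "z \<ge> 1" unfolding z_def using gn g0 by (intro ge_one_powr_ge_zero) auto
  have z3: "z ^ 3 = n / ?g" unfolding z_def using g0 len by (simp add: powr_power)
  define q where "q = nat \<lceil>z\<rceil>"
  have q: "z \<le> q" "q \<le> 2 * z" unfolding q_def using z1 by linarith+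
  have "real q * ?N \<le> ?g * real q ^ 3 + n"
    using count[of q] len by (metis of_nat_add of_nat_le_iff of_nat_mult of_nat_power)
  then have "?N \<le> ?g * real q ^ 2 + n / q"
    using q z1 by (simp add: field_simps power3_eq_cube power2_eq_square)
  also have "\<dots> \<le> ?g * (2 * z) ^ 2 + n / z"
    using q z1 g0 by (intro add_mono mult_left_mono power_mono divide_left_mono) auto
  also have "n / z = ?g * z ^ 2"
    using z3 g0 z1 by (simp add: field_simps power3_eq_cube power2_eq_square)
  \<comment> \<open>The 5 is \<open>2 ^ 2 + 1\<close>; with size at most \<open>4 * ?N\<close> it
    gives the constant 20.\<close>
  finally have "?N \<le> 5 * ?g * z ^ 2" by (simp add: power_mult_distrib)
  then have "slp_size (lz78 w) / ?g \<le> 20 * z ^ 2"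
    using size g0 by (simp add: field_simps)
  also have "z ^ 2 = (n / ?g) powr (2 / 3)"
    unfolding z_def using g0 len by (simp add: powr_power)
  also have "20 * (n / ?g) powr (2 / 3) \<le> 20 * (n / ln n) powr (2 / 3)"
    using lng lnn by (intro mult_left_mono powr_mono2 divide_left_mono) auto
  finally show ?thesis by simp
qed

text \<open>\<open>Max\<close> is meaningful here: the words of length \<open>n\<close> over
  \<open>{1..k}\<close> are finitely many and include a constant one.\<close>

lemma approx_ratio_bounds:
  assumes "k \<ge> 1"
  shows "(\<And>w. set w \<subseteq> {1..k} \<Longrightarrow> length w = n \<Longrightarrow> slp_size (C w) / smallest_slp_size w \<le> B) \<Longrightarrow>
      approx_ratio C k n \<le> B"
    and "set w \<subseteq> {1..k} \<Longrightarrow> length w = n \<Longrightarrow> slp_size (C w) / smallest_slp_size w \<le> approx_ratio C k n"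
proof -
  let ?S = "{slp_size (C w) / smallest_slp_size w | w. set w \<subseteq> {1..k} \<and> length w = n}"
  have "?S = (\<lambda>w. slp_size (C w) / smallest_slp_size w) ` {w. set w \<subseteq> {1..k} \<and> length w = n}"
    by blast
  then have fin: "finite ?S" by (simp add: finite_lists_length_eq)
  have "set (replicate n (1::nat)) \<subseteq> {1..k} \<and> length (replicate n (1::nat)) = n"
    using assms by auto
  then have ne: "?S \<noteq> {}" by blast
  show "approx_ratio C k n \<le> B"
    if "\<And>w. set w \<subseteq> {1..k} \<Longrightarrow> length w = n \<Longrightarrow> slp_size (C w) / smallest_slp_size w \<le> B"
    unfolding approx_ratio_def using fin ne that by (subst Max_le_iff) auto
  show "slp_size (C w) / smallest_slp_size w \<le> approx_ratio C k n"
    if "set w \<subseteq> {1..k}" "length w = n"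
    unfolding approx_ratio_def using fin that by (intro Max_ge) auto
qed

section \<open>Words with many phrases and a small straight-line program\<close>

text \<open>The shift to \<open>Suc t\<close> makes the indices \<open>t < m\<close> stand for inner
  runs of 1 to \<open>m\<close> letters.\<close>

definition mixed_block :: "'a \<Rightarrow> 'a \<Rightarrow> nat \<Rightarrow> 'a list" where
  "mixed_block a b t = b # replicate (Suc t) a @ [b]"

text \<open>The sum is the total length of the phrases \<open>a\<close>, \<open>aa\<close>, ...,
  \<open>a^K\<close>.\<close>

definition hard_prefix :: "'a \<Rightarrow> 'a \<Rightarrow> nat \<Rightarrow> nat \<Rightarrow> 'a list" where
  "hard_prefix a b m K =
     replicate (\<Sum>i<K. Suc i) a @
     concat (replicate ((Suc K)\<^sup>2) (b # replicate K a)) @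
     concat (replicate ((Suc K)\<^sup>2) (periodic a (mixed_block a b) m K))"

lemma length_concat_replicate: "length (concat (replicate N u)) = N * length u"
  by (simp add: length_concat sum_list_replicate)

lemma length_periodic_mixed_block:
  "m \<le> K \<Longrightarrow> length (periodic a (mixed_block a b) m K) \<le> m * (2 * Suc K)"
proof -
  assume mK: "m \<le> K"
  have "length (periodic a (mixed_block a b) m K) = (\<Sum>t<m. t + 3 + K)"
    by (simp add: periodic_def mixed_block_def length_concat o_def interv_sum_list_conv_sum_set_nat
        atLeast0LessThan numeral_3_eq_3)
  also have "\<dots> \<le> m * (2 * Suc K)"
    using sum_bounded_above[of "{..<m}" "\<lambda>t. t + 3 + K" "2 * Suc K"] mK by simp
  finally show ?thesis .
qed

text \<open>Strictness leaves at least one letter of padding when the prefix is extended to length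
  \<open>n\<close>.\<close>

lemma length_hard_prefix_less:
  assumes m: "m > 0" "m \<le> K"
  shows "length (hard_prefix a b m K) < 4 * m * Suc K ^ 3"
proof -
  let ?Q = "Suc K"
  have 1: "(\<Sum>i<K. Suc i) \<le> K * K"
    using sum_bounded_above[of "{..<K}" Suc K] by simp
  have 2: "?Q\<^sup>2 * length (periodic a (mixed_block a b) m K) \<le> ?Q\<^sup>2 * (m * (2 * ?Q))"
    using length_periodic_mixed_block[OF m(2)] by (rule mult_le_mono2)
  have "length (hard_prefix a b m K) \<le> K * K + ?Q\<^sup>2 * ?Q + ?Q\<^sup>2 * (m * (2 * ?Q))"
  proof -
    have "length (hard_prefix a b m K) =
        (\<Sum>i<K. Suc i) + ?Q\<^sup>2 * ?Q + ?Q\<^sup>2 * length (periodic a (mixed_block a b) m K)"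
      by (simp add: hard_prefix_def length_concat_replicate)
    then show ?thesis using 1 2 by linarith
  qed
  also have "\<dots> < ?Q ^ 3 + ?Q ^ 3 + 2 * m * ?Q ^ 3"
  proof -
    have "K * K < ?Q ^ 3" by (simp add: power3_eq_cube algebra_simps)
    then show ?thesis by (simp add: power3_eq_cube power2_eq_square algebra_simps)
  qed
  also have "\<dots> \<le> 4 * m * ?Q ^ 3"
  proof -
    have "1 * ?Q ^ 3 \<le> m * ?Q ^ 3" using m by (intro mult_le_mono1) simp
    then show ?thesis by simp
  qed
  finally show ?thesis .
qed

section \<open>Runs, separators and the phrases of the three blocks\<close>

lemma replicate_Cons_eq_iff:
  assumes "a \<noteq> b"
  shows "replicate x a @ b # u = replicate x' a @ b # u' \<longleftrightarrow> x = x' \<and> u = u'"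
proof (induction x arbitrary: x')
  case 0
  show ?case using assms by (cases x') auto
next
  case (Suc x)
  show ?case using assms Suc.IH by (cases x') auto
qed

lemma count_list_replicate_neq: "a \<noteq> b \<Longrightarrow> count_list (replicate n a) b = 0"
  by (induction n) simp_all

lemma lz78_dict_runs:
  "lz78_dict (map (\<lambda>i. replicate (Suc i) a) [0..<K]) \<and>
   concat (map (\<lambda>i. replicate (Suc i) a) [0..<K]) = replicate (\<Sum>i<K. Suc i) a"
proof (induction K)
  case 0
  show ?case by (simp add: lz78_dict_def)
next
  case (Suc K)
  let ?D = "map (\<lambda>i. replicate (Suc i) a) [0..<K]"
  have "replicate (Suc K) a \<notin> set ([] # ?D)"
    by (auto dest: arg_cong[of _ _ length])
  moreover have "replicate K a \<in> set ([] # ?D)"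
    by (cases K) auto
  moreover have "replicate (Suc K) a = replicate K a @ [a]" by (simp add: replicate_append_same)
  ultimately have "lz78_dict (?D @ [replicate (Suc K) a])"
    using Suc unfolding lz78_dict_snoc by blast
  moreover have "concat (?D @ [replicate (Suc K) a]) = replicate (\<Sum>i<Suc K. Suc i) a"
    using Suc by (simp flip: replicate_add del: replicate_Suc)
  ultimately show ?case by simp
qed

text \<open>Phrases of the three blocks contain 0, 1 and 2 letters \<open>b\<close>, so those of a
  later block are new. Each block provides the prefixes that \<open>pre\<close> demands for the next
  one.\<close>

lemma hard_prefix_parse:
  assumes ab: "a \<noteq> b" and m: "m > 0" "m \<le> K"
  obtains D where "lz78_dict D" "concat D = hard_prefix a b m K" "m * (Suc K)\<^sup>2 \<le> length D"
proof -
  let ?D0 = "map (\<lambda>i. replicate (Suc i) a) [0..<K]"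
  let ?c1 = "\<lambda>_::nat. [b]" and ?c2 = "mixed_block a b"
  have run: "replicate x a \<in> set ([] # ?D0)" if "x \<le> K" for x
    using that by (cases x) auto
  have count0: "count_list u b = 0" if "u \<in> set ([] # ?D0)" for u
    using that count_list_replicate_neq[OF ab] by (auto simp del: replicate_Suc)
  have count1: "count_list (separated a ?c1 e) b = 1" for e
    using count_list_replicate_neq[OF ab] ab by (cases e) (simp add: separated_def)
  have count2: "count_list (separated a ?c2 e) b = 2" for e
    using count_list_replicate_neq[OF ab] ab by (cases e) (simp add: separated_def mixed_block_def)
  \<comment> \<open>The second block is the case of a single separator \<open>[b]\<close>.\<close>
  obtain F1 where F1: "lz78_dict (?D0 @ F1)" "set F1 = separated a ?c1 ` edges 1 K"
    "concat F1 = concat (replicate ((Suc K)\<^sup>2) (periodic a ?c1 1 K))"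
  proof (rule lz78_parse_periodic)
    show "lz78_dict ?D0" using lz78_dict_runs[of a K] by (rule conjunct1)
    show "inj_on (separated a ?c1) (edges 1 K)"
      using replicate_Cons_eq_iff[OF ab] by (auto simp: inj_on_def separated_def edges_def)
    show "replicate x a @ butlast [b] \<in> set ([] # ?D0)" if "x \<le> K" for x
      using run[OF that] by simp
    show "separated a ?c1 e \<notin> set ([] # ?D0)" for e
      using count0 count1[of e] by (metis zero_neq_one)
  qed auto
  let ?D1 = "?D0 @ F1"
  have count_le1: "count_list u b \<le> 1" if "u \<in> set ([] # ?D1)" for u
  proof -
    have "u \<in> set ([] # ?D0) \<or> u \<in> set F1" using that by auto
    then show ?thesis using count0 count1 F1(2) by fastforce
  qed
  obtain F2 where F2: "lz78_dict (?D1 @ F2)" "set F2 = separated a ?c2 ` edges m K"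
    "concat F2 = concat (replicate ((Suc K)\<^sup>2) (periodic a ?c2 m K))"
  proof (rule lz78_parse_periodic)
    show "lz78_dict ?D1" by fact
    show inj: "inj_on (separated a ?c2) (edges m K)"
      using replicate_Cons_eq_iff[OF ab]
      by (auto simp: inj_on_def separated_def mixed_block_def simp del: replicate_Suc)
    show "replicate x a @ butlast (?c2 t) \<in> set ([] # ?D1)" if "x \<le> K" "t < m" for x t
    proof -
      \<comment> \<open>Without its last \<open>b\<close> the word is a phrase of the second block;
        \<open>m \<le> K\<close> makes its final run short enough.\<close>
      have "replicate x a @ butlast (?c2 t) = separated a ?c1 (x, 0, Suc t)"
        by (simp add: separated_def mixed_block_def butlast_append)
      moreover have "(x, 0, Suc t) \<in> edges 1 K" using that m by (auto simp: edges_def)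
      ultimately show ?thesis using F1(2) by auto
    qed
    show "separated a ?c2 e \<notin> set ([] # ?D1)" for e
      using count_le1[of "separated a ?c2 e"] count2[of e] by auto
  qed (use m in \<open>auto simp: mixed_block_def\<close>)
  have inj: "inj_on (separated a ?c2) (edges m K)"
    using replicate_Cons_eq_iff[OF ab]
    by (auto simp: inj_on_def separated_def mixed_block_def simp del: replicate_Suc)
  have "m * (Suc K)\<^sup>2 = card (edges m K)"
    by (simp add: edges_def card_cartesian_product power2_eq_square algebra_simps)
  also have "\<dots> = card (set F2)" unfolding F2(2) by (rule card_image[OF inj, symmetric])
  also have "\<dots> \<le> length (?D1 @ F2)" using card_length[of F2] by simp
  finally have "m * (Suc K)\<^sup>2 \<le> length (?D1 @ F2)" .
  moreover have "concat (?D1 @ F2) = hard_prefix a b m K"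
    using lz78_dict_runs[of a K] F1(3) F2(3)
    by (simp add: hard_prefix_def periodic_def)
  ultimately show ?thesis using that F2(1) by blast
qed

text \<open>The five powers (\<open>a^M\<close>, \<open>a^K\<close>, \<open>a^r\<close> and those of
  the two periods) cost \<open>3 * e\<close> each. The runs cost \<open>2 * m\<close>, the long
  period \<open>4 * m\<close>, the word \<open>b a^K\<close> 2 and the start rule 4.\<close>

lemma smallest_slp_size_hard:
  assumes m: "m > 0" "m \<le> K" and len: "length (hard_prefix a b m K) + r < 2 ^ e" and r: "r > 0"
  shows "smallest_slp_size (hard_prefix a b m K @ replicate r a) \<le> 15 * e + 6 * m + 6"
proof -
  let ?M = "\<Sum>i<K. Suc i" and ?N = "(Suc K)\<^sup>2" and ?\<Pi> = "periodic a (mixed_block a b) m K"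
  have "length (hard_prefix a b m K) = ?M + ?N * Suc K + ?N * length ?\<Pi>"
    by (simp add: hard_prefix_def length_concat_replicate)
  then have lt: "?M < 2 ^ e" "?N * Suc K < 2 ^ e" "r < 2 ^ e" using len by linarith+
  have "?N \<le> ?N * Suc K" "K \<le> ?N * Suc K" by (auto simp: power2_eq_square)
  then have lt': "?N < 2 ^ e" "K < 2 ^ e" using lt(2) by linarith+
  have "?M \<ge> 1" using m sum_bounded_below[of "{..<K}" 1 Suc] by simp
  obtain S1 c1 where 1: "sl_computes S1 c1" "c1 \<le> 0 + 3 * e" "replicate ?M a \<in> S1"
    using sl_computes_run[OF sl_computes.empty \<open>?M \<ge> 1\<close> lt(1)] by metis
  obtain S2 c2 where 2: "sl_computes S2 c2" "c2 \<le> c1 + 3 * e" "S1 \<subseteq> S2" "replicate K a \<in> S2"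
    using sl_computes_run[OF 1(1) _ lt'(2)] m by (metis One_nat_def Suc_leI less_le_trans)
  obtain S3 c3 where 3: "sl_computes S3 c3" "c3 \<le> c2 + 2 * m" "S2 \<subseteq> S3"
    "\<And>t. t < m \<Longrightarrow> replicate (Suc t) a \<in> S3"
    using sl_computes_runs[OF 2(1)] by metis
  let ?B = "b # replicate K a"
  have 4: "sl_computes (insert (concat [[b], replicate K a]) S3) (c3 + length [[b], replicate K a])"
    using 2 3 by (intro sl_computes.step) auto
  obtain S5 c5 where 5: "sl_computes S5 c5" "c5 \<le> c3 + 2 + 3 * e" "insert ?B S3 \<subseteq> S5"
    "concat (replicate ?N ?B) \<in> S5"
    using sl_computes_power[OF 4 _ _ lt'(1), of ?B] by auto
  let ?us = "concat (map (\<lambda>t. [[b], replicate (Suc t) a, [b], replicate K a]) [0..<m])"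
  have len_us: "length ?us = 4 * m"
    by (simp add: length_concat o_def sum_list_triv)
  have "concat (concat (map (\<lambda>t. [[b], replicate (Suc t) a, [b], replicate K a]) ts)) =
      concat (map (\<lambda>t. mixed_block a b t @ replicate K a) ts)" for ts
    by (induction ts) (simp_all add: mixed_block_def)
  then have "concat ?us = ?\<Pi>" by (simp add: periodic_def)
  moreover have "sl_computes (insert (concat ?us) S5) (c5 + length ?us)"
  proof (rule sl_computes.step[OF 5(1)])
    show "?us \<noteq> []" using len_us m by force
    have "replicate K a \<in> S5" "\<And>t. t < m \<Longrightarrow> replicate (Suc t) a \<in> S5"
      using 2(4) 3(3,4) 5(3) by auto
    then show "u \<in> S5 \<or> length u = 1" if "u \<in> set ?us" for u
      using that by (auto simp del: replicate_Suc split: if_splits)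
  qed
  ultimately have 6: "sl_computes (insert ?\<Pi> S5) (c5 + 4 * m)" using len_us by simp
  obtain S7 c7 where 7: "sl_computes S7 c7" "c7 \<le> c5 + 4 * m + 3 * e" "insert ?\<Pi> S5 \<subseteq> S7"
    "concat (replicate ?N ?\<Pi>) \<in> S7"
    using sl_computes_power[OF 6 _ _ lt'(1), of ?\<Pi>] by auto
  obtain S8 c8 where 8: "sl_computes S8 c8" "c8 \<le> c7 + 3 * e" "S7 \<subseteq> S8" "replicate r a \<in> S8"
    using sl_computes_run[OF 7(1) _ lt(3)] r by (metis One_nat_def Suc_leI)
  let ?ws = "[replicate ?M a, concat (replicate ?N ?B), concat (replicate ?N ?\<Pi>), replicate r a]"
  have "S1 \<subseteq> S8" "S5 \<subseteq> S8" "S7 \<subseteq> S8" using 2(3) 3(3) 5(3) 7(3) 8(3) by blast+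
  then have "set ?ws \<subseteq> S8" using 1(3) 5(4) 7(4) 8(4) by auto
  then have "sl_computes (insert (concat ?ws) S8) (c8 + length ?ws)"
    using 8(1) by (intro sl_computes.step) auto
  then have "smallest_slp_size (concat ?ws) \<le> c8 + length ?ws"
    by (rule smallest_slp_size_le) simp
  also have "concat ?ws = hard_prefix a b m K @ replicate r a"
    by (simp add: hard_prefix_def)
  also have "c8 + length ?ws \<le> 15 * e + 6 * m + 6"
    using 1(2) 2(2) 3(2) 5(2) 7(2) 8(2) by simp
  finally show ?thesis .
qed

text \<open>Padding only appends phrases: parsing continues from the dictionary \<open>D\<close> and
  keeps all its entries.\<close>

lemma hard_word:
  assumes ab: "a \<noteq> b" and m: "m > 0" "m \<le> K" and n: "4 * m * Suc K ^ 3 \<le> n" "n < 2 ^ e"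
  obtains w where "set w \<subseteq> {a, b}" "length w = n" "m * (Suc K)\<^sup>2 \<le> slp_size (lz78 w)"
    "smallest_slp_size w \<le> 15 * e + 6 * m + 6"
proof -
  let ?h = "hard_prefix a b m K"
  define r where "r = n - length ?h"
  have len: "length ?h + r = n" and r: "r > 0"
    using length_hard_prefix_less[OF m, of a b] n by (simp_all add: r_def)
  let ?w = "?h @ replicate r a"
  obtain D where D: "lz78_dict D" "concat D = ?h" "m * (Suc K)\<^sup>2 \<le> length D"
    using hard_prefix_parse[OF ab m] .
  obtain F x where F: "replicate r a = concat F @ x" "lz78_dict (D @ F)" "x \<in> set ([] # D @ F)"
    using lz78_factors_exist[OF D(1)] by blast
  have "?w \<noteq> []" using r by simp
  moreover have "?w = concat (D @ F) @ x" using D(2) F(1) by simp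
  moreover note F(2,3)
  ultimately have "length (D @ F) \<le> slp_size (lz78 ?w)" by (rule lz78_size_bounds(1))
  then have "m * (Suc K)\<^sup>2 \<le> slp_size (lz78 ?w)" using D(3) by simp
  moreover have "set ?w \<subseteq> {a, b}"
    by (auto simp: hard_prefix_def periodic_def mixed_block_def split: if_splits)
  moreover have "smallest_slp_size ?w \<le> 15 * e + 6 * m + 6"
    using smallest_slp_size_hard[OF m _ r, of a b e] len n(2) by simp
  moreover have "length ?w = n" using len by simp
  ultimately show ?thesis using that by blast
qed

section \<open>Choice of the parameters, and both bounds combined\<close>

lemma lz78_ratio_lower:
  assumes n: "n \<ge> 3" and large: "ln n + 2 \<le> (n / (4 * ln n)) powr (1 / 3)"
    and ab: "a \<noteq> b"
  obtains w where "set w \<subseteq> {a, b}" "length w = n"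
    "1 / 3000 * (n / ln n) powr (2 / 3) \<le> slp_size (lz78 w) / smallest_slp_size w"
proof -
  define m where "m = nat \<lfloor>ln n\<rfloor>"
  define z where "z = (n / (4 * ln n)) powr (1 / 3)"
  \<comment> \<open>\<open>Suc K\<close> is the floor of \<open>z\<close>, so that
    \<open>4 * m * Suc K ^ 3 \<le> n\<close>; \<open>large\<close> ensures
    \<open>m \<le> K\<close>.\<close>
  define K where "K = nat \<lfloor>z\<rfloor> - 1"
  have "exp 1 \<le> real n" using n exp_le by linarith
  then have ln1: "ln n \<ge> 1" using n by (subst ln_ge_iff) auto
  have m: "m \<ge> 1" "m \<le> ln n" "ln n < m + 1" using ln1 by (simp_all add: m_def le_nat_iff) linarith+
  have z: "m + 2 \<le> z" using large m(2) by (simp add: z_def)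
  have K: "Suc K \<le> z" "z < Suc K + 1" using z by (simp_all add: K_def Suc_diff_le le_nat_iff) linarith+
  have mK: "m \<le> K" using z K by linarith
  have z3: "z ^ 3 = n / (4 * ln n)" unfolding z_def using n ln1 by (simp add: powr_power)
  have "real (4 * m * Suc K ^ 3) \<le> 4 * ln n * z ^ 3"
    using m(2) K(1) by (auto intro!: mult_mono power_mono simp del: of_nat_Suc)
  also have "\<dots> = n" unfolding z3 using ln1 by simp
  finally have len: "4 * m * Suc K ^ 3 \<le> n" by (simp only: of_nat_le_iff)
  \<comment> \<open>Bounding \<open>exp 1\<close> by 4 gives a binary length linear in
    \<open>m\<close>, hence a program of size \<open>O(m)\<close>.\<close>
  have "real n = exp (ln n)" using n by simp
  also have "\<dots> < exp (m + 1)" using m(3) by simp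
  also have "\<dots> = exp 1 ^ (m + 1)" by (simp add: exp_add exp_of_nat_mult[symmetric])
  also have "\<dots> \<le> 4 ^ (m + 1)" using exp_le by (intro power_mono) auto
  also have "\<dots> = real (2 ^ (2 * (m + 1)))" by (simp add: power_mult)
  finally have e: "n < 2 ^ (2 * (m + 1))" by (simp only: of_nat_less_iff)
  obtain w where w: "set w \<subseteq> {a, b}" "length w = n" "m * (Suc K)\<^sup>2 \<le> slp_size (lz78 w)"
    "smallest_slp_size w \<le> 15 * (2 * (m + 1)) + 6 * m + 6"
    using hard_word[OF ab _ mK len e] m(1) by (auto simp: Suc_le_eq)
  have g: "smallest_slp_size w \<le> 72 * m" using w(4) m(1) by simp
  have "w \<noteq> []" using w(2) n by auto
  from ln_le_smallest_slp_size[OF this] have g0: "smallest_slp_size w > 0"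
    using w(2) ln1 by simp
  have "(n / ln n) powr (2 / 3) = 4 powr (2 / 3) * (n / (4 * ln n)) powr (2 / 3)"
    using ln1 by (simp flip: powr_mult)
  also have "(n / (4 * ln n)) powr (2 / 3) = z ^ 2"
    unfolding z_def using n ln1 by (simp add: powr_power)
  also have "4 powr (2 / 3) * z ^ 2 \<le> 4 * z ^ 2"
    using powr_mono[of "2 / 3" 1 "4::real"] by (intro mult_right_mono) auto
  also have "4 * z ^ 2 \<le> 4 * (2 * real (Suc K)) ^ 2"
    using K(2) z by (intro mult_left_mono power_mono) auto
  also have "\<dots> = 16 * real (Suc K) ^ 2" by (simp only: power_mult_distrib) simp
  \<comment> \<open>The chain ends at \<open>16 * (Suc K)\<^sup>2\<close>, and
    \<open>16 * 72 = 1152 \<le> 3000\<close>.\<close>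
  finally have "1 / 3000 * (n / ln n) powr (2 / 3) \<le> real (Suc K) ^ 2 / 72"
    using zero_le_power2[of "real (Suc K)"] by linarith
  also have "\<dots> = real (m * (Suc K)\<^sup>2) / real (72 * m)" using m(1) by simp
  also have "\<dots> \<le> slp_size (lz78 w) / smallest_slp_size w"
    using w(3) g g0 m(1) by (intro frac_le) (auto simp del: of_nat_mult)
  finally show ?thesis using that w(1,2) by blast
qed

lemma eventually_ln_le_powr:
  "eventually (\<lambda>n. ln (real n) + 2 \<le> (n / (4 * ln n)) powr (1 / 3)) sequentially"
  by real_asymp

theorem theorem3p4:
  shows "\<exists>(c1::real) (c2::real) (n0::nat). c1 > 0 \<and> c2 > 0 \<and>
    (\<forall>n k :: nat. n0 \<le> n \<and> 2 \<le> k \<and> k \<le> n \<longrightarrow>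
       c1 * (real n / ln (real n)) powr (2 / 3) \<le> approx_ratio lz78 k n \<and>
       approx_ratio lz78 k n \<le> c2 * (real n / ln (real n)) powr (2 / 3))"
proof -
  obtain n0 where n0: "\<And>n. n \<ge> n0 \<Longrightarrow> ln (real n) + 2 \<le> (n / (4 * ln n)) powr (1 / 3)"
    using eventually_ln_le_powr unfolding eventually_sequentially by blast
  show ?thesis
  proof (rule exI[of _ "1 / 3000"], rule exI[of _ 20], rule exI[of _ "max n0 3"],
      intro conjI allI impI)
    fix n k :: nat
    assume "max n0 3 \<le> n \<and> 2 \<le> k \<and> k \<le> n"
    then have n: "n0 \<le> n" "3 \<le> n" and k: "2 \<le> k" by auto
    \<comment> \<open>Two letters suffice for the hard words, so one lower bound serves every
      \<open>k \<ge> 2\<close>.\<close>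
    obtain w :: "nat list" where w: "set w \<subseteq> {1, 2}" "length w = n"
      "1 / 3000 * (n / ln n) powr (2 / 3) \<le> slp_size (lz78 w) / smallest_slp_size w"
      using lz78_ratio_lower[OF n(2) n0[OF n(1)], of "1 :: nat" 2] by auto
    have "set w \<subseteq> {1..k}" using w(1) k by auto
    then have "slp_size (lz78 w) / smallest_slp_size w \<le> approx_ratio lz78 k n"
      using k w(2) by (intro approx_ratio_bounds(2)) auto
    with w(3) show "1 / 3000 * (real n / ln (real n)) powr (2 / 3) \<le> approx_ratio lz78 k n"
      by linarith
    show "approx_ratio lz78 k n \<le> 20 * (real n / ln (real n)) powr (2 / 3)"
      using k n(2) by (intro approx_ratio_bounds(1) lz78_ratio_upper) auto
  qed simp_all
qed

end
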